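(* Let $\mathbf{C}\in\mathbb{R}^{k\times k}$ be a symmetric matrix with distinct eigenvalues $1=\lambda_1>\lambda_2>\cdots>\lambda_k\ge 0$, let $b$ be a positive integer dividing $k$, set $t=k/b$, and let $\mathbf{H}\in\mathbb{R}^{k\times b}$ have i.i.d. standard Gaussian entries. There is a universal constant $\mathrm{C}>0$ such that for every $\delta\in(0,1)$, \[ \Pr\left[ \sigma_{\min}\left( \begin{bmatrix} \mathbf{H} & \mathbf{C} \mathbf{H} & \cdots & \mathbf{C}^{t-1}\mathbf{H} \end{bmatrix} \right) \geq \mathrm{C} \cdot \frac{\delta^5}{k^{14}}\left(\frac{\Delta_k}{6\kappa_k}\right)^{6(t-1)}\right] \geq 1-\delta, \] where $\Delta_k=\min_{i=1,\dots,k-1}(\lambda_i-\lambda_{i+1})/\lambda_i$ and $\kappa_k=\lambda_1/\lambda_{k-1}$.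
   Context: The matrix $[\mathbf{H},\mathbf{C}\mathbf{H},\dots,\mathbf{C}^{t-1}\mathbf{H}]$ is $k\times k$, and $\sigma_{\min}$ denotes its smallest singular value. *)

theory Defs
  imports "HOL-Probability.Probability" "Jordan_Normal_Form.Spectral_Radius"
begin

text \<open>For a real matrix with at least as many rows as columns (in particular a square one)
  these are all its singular values; a matrix with more columns than rows would get an
  additional value 0.\<close>

definition singular_values :: "real mat \<Rightarrow> real set" where
  "singular_values A = sqrt ` spectrum (A\<^sup>T * A)"

definition sigma_min :: "real mat \<Rightarrow> real" where
  "sigma_min A = Min (singular_values A)"

text \<open>The block matrix \<open>[H, C H, \<dots>, C\<^sup>t\<^sup>-\<^sup>1 H]\<close>: with \<open>b = dim_col H\<close>,
  column \<open>j = s b + r\<close> with \<open>r < b\<close> is column \<open>r\<close> of \<open>C\<^sup>s H\<close>.\<close>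

definition krylov_mat :: "real mat \<Rightarrow> real mat \<Rightarrow> nat \<Rightarrow> real mat" where
  "krylov_mat C H t = mat (dim_row H) (t * dim_col H)
     (\<lambda>(i, j). (C ^\<^sub>m (j div dim_col H) * H) $$ (i, j mod dim_col H))"

text \<open>The law of a \<open>k \<times> b\<close> array of i.i.d. standard Gaussians; a sample \<open>\<omega>\<close> is turned into a
  matrix by \<open>mat k b \<omega>\<close>.\<close>

definition gaussian_entries :: "nat \<Rightarrow> nat \<Rightarrow> (nat \<times> nat \<Rightarrow> real) measure" where
  "gaussian_entries k b =
     PiM ({..<k} \<times> {..<b}) (\<lambda>_. density lborel (\<lambda>x. ennreal (std_normal_density x)))"

text \<open>In the next two definitions the eigenvalues are indexed by \<open>1, \<dots>, k\<close>, and \<open>k \<ge> 2\<close> is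
  needed for the values to be meaningful.\<close>

definition min_rel_gap :: "nat \<Rightarrow> (nat \<Rightarrow> real) \<Rightarrow> real" where
  "min_rel_gap k l = Min ((\<lambda>i. (l i - l (i + 1)) / l i) ` {1..k - 1})"

definition eig_ratio :: "nat \<Rightarrow> (nat \<Rightarrow> real) \<Rightarrow> real" where
  "eig_ratio k l = l 1 / l (k - 1)"

end

theory Submission
  imports Defs
begin

text \<open>
  Let \<open>q\<^sub>1, \<dots>, q\<^sub>k\<close> be orthonormal eigenvectors of \<open>C\<close> and \<open>z\<^sub>i\<^sub>r = \<langle>q\<^sub>i, h\<^sub>r\<rangle>\<close>, where \<open>h\<^sub>r\<close> are
  the columns of \<open>H\<close>. In this basis the Krylov matrix has entries \<open>\<lambda>\<^sub>i\<^sup>s z\<^sub>i\<^sub>r\<close>, so its determinant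
  \<open>f\<close> is affine in each \<open>z\<^sub>i\<^sub>r\<close>. An entry of the inverse is \<open>n / f\<close> for a cofactor \<open>n\<close>; if \<open>n\<close>
  belongs to a column in block position \<open>r\<close>, then as polynomials in the \<open>r\<close>-th column of \<open>z\<close> alone,
  \<open>f\<close> is multilinear of degree \<open>t\<close>, \<open>n\<close> is multilinear of degree \<open>t - 1\<close>, and by Lagrange
  interpolation each coefficient of \<open>n\<close> is at most \<open>(2 / \<eta>)\<^sup>t\<^sup>-\<^sup>1\<close> times one of \<open>f\<close>, where \<open>\<eta>\<close> bounds
  the eigenvalue gaps from below. Since \<open>E |a x + b|\<^sup>-\<^sup>1\<^sup>/\<^sup>2 \<le> 4 |a|\<^sup>-\<^sup>1\<^sup>/\<^sup>2\<close> for a standard Gaussian \<open>x\<close>,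
  integrating out \<open>t\<close> variables one at a time bounds \<open>E |n / f|\<^sup>1\<^sup>/\<^sup>2\<close> by
  \<open>(2 / \<eta>)\<^sup>(\<^sup>t\<^sup>-\<^sup>1\<^sup>)\<^sup>/\<^sup>2 k\<^sup>t\<^sup>-\<^sup>1 4\<^sup>t\<close>: the power of \<open>\<delta>\<close> does not depend on \<open>t\<close>. Factors \<open>k\<^sup>2\<^sup>(\<^sup>t\<^sup>-\<^sup>1\<^sup>)\<close> are harmless
  because \<open>\<eta> = \<Delta>\<^sub>k / \<kappa>\<^sub>k\<close> satisfies \<open>(k - 1) \<eta> \<le> 1\<close>.
\<close>

section \<open>Gaussian measure and resampling of a direction\<close>

abbreviation std_normal :: "real measure" where
  "std_normal \<equiv> density lborel (\<lambda>x. ennreal (std_normal_density x))"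

abbreviation gauss :: "'a set \<Rightarrow> ('a \<Rightarrow> real) measure" where
  "gauss I \<equiv> PiM I (\<lambda>_. std_normal)"

definition dir_coord :: "'a set \<Rightarrow> ('a \<Rightarrow> real) \<Rightarrow> ('a \<Rightarrow> real) \<Rightarrow> real" where
  "dir_coord I d \<omega> = (\<Sum>a\<in>I. d a * \<omega> a)"

text \<open>The restriction to \<open>I\<close> keeps the shifted point in the extensional space of
  \<open>PiM I\<close>, so that shifts by \<open>x\<close> and by \<open>-x\<close> cancel exactly
  there.\<close>

definition shift_along :: "'a set \<Rightarrow> ('a \<Rightarrow> real) \<Rightarrow> real \<Rightarrow> ('a \<Rightarrow> real) \<Rightarrow> 'a \<Rightarrow> real" where
  "shift_along I d x \<omega> = (\<lambda>a\<in>I. \<omega> a + x * d a)"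

lemma dir_coord_shift:
  "dir_coord I e (shift_along I d x \<omega>) = dir_coord I e \<omega> + x * (\<Sum>a\<in>I. e a * d a)"
  by (simp add: dir_coord_def shift_along_def algebra_simps sum.distrib sum_distrib_left)

lemma prob_space_std_normal: "prob_space std_normal"
  by (rule prob_space_normal_density) simp

lemma product_sigma_finite_lborel: "product_sigma_finite (\<lambda>_. lborel :: real measure)"
  by (simp add: product_sigma_finite_def lborel.sigma_finite_measure_axioms)

lemma product_prob_space_std_normal: "product_prob_space (\<lambda>_. std_normal)"
  by (simp add: product_prob_space_def product_prob_space_axioms_def product_sigma_finite_def
      prob_space_std_normal prob_space_imp_sigma_finite)

lemma prob_space_gauss: "prob_space (gauss I)"
  by (intro prob_space_PiM prob_space_std_normal)

lemma sets_gauss: "sets (gauss I) = sets (PiM I (\<lambda>_. lborel))"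
  by (rule sets_PiM_cong) auto

text \<open>Both measures agree on boxes, where the integral of the product density factorises. In
  this form Lebesgue translations can be applied to Gaussian integrals.\<close>

lemma gauss_eq_density:
  assumes "finite I"
  shows "gauss I = density (PiM I (\<lambda>_. lborel)) (\<lambda>\<omega>. \<Prod>i\<in>I. ennreal (std_normal_density (\<omega> i)))"
    (is "_ = ?D")
proof -
  interpret N: product_prob_space "\<lambda>_::'a. std_normal" by (rule product_prob_space_std_normal)
  interpret L: product_sigma_finite "\<lambda>_::'a. lborel :: real measure" by (rule product_sigma_finite_lborel)
  have "?D = gauss I"
  proof (rule N.PiM_eqI[OF assms])
    show "sets ?D = sets (gauss I)" by (simp add: sets_gauss)
    fix A :: "'a \<Rightarrow> real set" assume "\<And>i. i \<in> I \<Longrightarrow> A i \<in> sets std_normal"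
    then have A: "\<And>i. i \<in> I \<Longrightarrow> A i \<in> sets borel" by simp
    have PA: "Pi\<^sub>E I A \<in> sets (Pi\<^sub>M I (\<lambda>_. lborel))"
      using A by (intro sets_PiM_I_finite assms) auto
    have "emeasure ?D (Pi\<^sub>E I A) = (\<integral>\<^sup>+\<omega>. (\<Prod>i\<in>I. ennreal (std_normal_density (\<omega> i)))
            * indicator (Pi\<^sub>E I A) \<omega> \<partial>PiM I (\<lambda>_. lborel))"
      by (rule emeasure_density) (use PA in measurable)
    also have "\<dots> = (\<integral>\<^sup>+\<omega>. (\<Prod>i\<in>I. ennreal (std_normal_density (\<omega> i)) * indicator (A i) (\<omega> i))
            \<partial>PiM I (\<lambda>_. lborel))"
    proof (rule nn_integral_cong)
      fix \<omega> :: "'a \<Rightarrow> real" assume "\<omega> \<in> space (PiM I (\<lambda>_. lborel))"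
      then have "indicator (Pi\<^sub>E I A) \<omega> = (\<Prod>i\<in>I. indicator (A i) (\<omega> i) :: ennreal)"
        using assms by (auto simp: space_PiM indicator_def PiE_iff prod_zero_iff)
      then show "(\<Prod>i\<in>I. ennreal (std_normal_density (\<omega> i))) * indicator (Pi\<^sub>E I A) \<omega>
          = (\<Prod>i\<in>I. ennreal (std_normal_density (\<omega> i)) * indicator (A i) (\<omega> i))"
        by (simp add: prod.distrib)
    qed
    also have "\<dots> = (\<Prod>i\<in>I. \<integral>\<^sup>+x. ennreal (std_normal_density x) * indicator (A i) x \<partial>lborel)"
      using A by (intro L.product_nn_integral_prod assms) auto
    also have "\<dots> = (\<Prod>i\<in>I. emeasure std_normal (A i))"
      using A by (intro prod.cong) (auto simp: emeasure_density)
    finally show "emeasure ?D (Pi\<^sub>E I A) = (\<Prod>i\<in>I. emeasure std_normal (A i))" .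
  qed
  then show ?thesis by simp
qed

text \<open>For fixed \<open>x\<close> this is a translation by a constant vector: it pulls boxes
  back to boxes, and each side moves by a translation of \<open>lborel\<close>.\<close>

lemma nn_integral_PiM_lborel_shift:
  assumes "finite I" and [measurable]: "f \<in> borel_measurable (PiM I (\<lambda>_. lborel))"
  shows "(\<integral>\<^sup>+\<omega>. f (shift_along I d x \<omega>) \<partial>PiM I (\<lambda>_. lborel)) = (\<integral>\<^sup>+\<omega>. f \<omega> \<partial>PiM I (\<lambda>_. lborel))"
proof -
  let ?L = "PiM I (\<lambda>_. lborel) :: ('a \<Rightarrow> real) measure"
  interpret L: product_sigma_finite "\<lambda>_::'a. lborel :: real measure" by (rule product_sigma_finite_lborel)
  have [measurable]: "shift_along I d x \<in> measurable ?L ?L"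
    unfolding shift_along_def by (measurable)
  have "distr ?L ?L (shift_along I d x) = ?L"
  proof (rule L.PiM_eqI[OF assms(1)])
    fix A :: "'a \<Rightarrow> real set" assume A: "\<And>i. i \<in> I \<Longrightarrow> A i \<in> sets lborel"
    then have [measurable]: "Pi\<^sub>E I A \<in> sets ?L" by (intro sets_PiM_I_finite assms)
    let ?B = "\<lambda>i. (\<lambda>y. x * d i + y) -` A i"
    have B: "?B i \<in> sets lborel" if "i \<in> I" for i
      using measurable_sets[of "\<lambda>y. x * d i + y" borel borel "A i"] A[OF that] by simp
    have "emeasure (distr ?L ?L (shift_along I d x)) (Pi\<^sub>E I A) = emeasure ?L (shift_along I d x -` Pi\<^sub>E I A \<inter> space ?L)"
      by (rule emeasure_distr) measurable
    also have "shift_along I d x -` Pi\<^sub>E I A \<inter> space ?L = Pi\<^sub>E I ?B"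
      by (auto simp: space_PiM shift_along_def PiE_iff add.commute)
    also have "emeasure ?L (Pi\<^sub>E I ?B) = (\<Prod>i\<in>I. emeasure lborel (?B i))"
      using B by (intro L.emeasure_PiM assms) auto
    also have "\<dots> = (\<Prod>i\<in>I. emeasure lborel (A i))"
    proof (rule prod.cong)
      fix i assume i: "i \<in> I"
      have "emeasure lborel (A i) = emeasure (distr lborel borel ((+) (x * d i))) (A i)"
        by (simp add: lborel_distr_plus)
      also have "\<dots> = emeasure lborel (?B i)"
        using A[OF i] by (subst emeasure_distr) auto
      finally show "emeasure lborel (?B i) = emeasure lborel (A i)" by simp
    qed simp
    finally show "emeasure (distr ?L ?L (shift_along I d x)) (Pi\<^sub>E I A) = (\<Prod>i\<in>I. emeasure lborel (A i))" .
  qed simp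
  then have "(\<integral>\<^sup>+\<omega>. f \<omega> \<partial>?L) = (\<integral>\<^sup>+\<omega>. f \<omega> \<partial>distr ?L ?L (shift_along I d x))" by simp
  also have "\<dots> = (\<integral>\<^sup>+\<omega>. f (shift_along I d x \<omega>) \<partial>?L)"
    by (rule nn_integral_distr) measurable
  finally show ?thesis by simp
qed

text \<open>The map \<open>(\<omega>, x) \<mapsto> (\<omega> + (x - \<langle>d, \<omega>\<rangle>) d, \<langle>d, \<omega>\<rangle>)\<close> is orthogonal, and up to
  a sign it is a product of three shears; so it preserves both the Lebesgue measure and the
  Gaussian density.\<close>

lemma gauss_resample:
  assumes I: "finite I" and d: "(\<Sum>a\<in>I. (d a)\<^sup>2) = 1"
    and f: "f \<in> borel_measurable (gauss I)"
  shows "(\<integral>\<^sup>+\<omega>. f \<omega> \<partial>gauss I) = (\<integral>\<^sup>+\<omega>. \<integral>\<^sup>+x. f (shift_along I d (x - dir_coord I d \<omega>) \<omega>) \<partial>std_normal \<partial>gauss I)"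
proof -
  let ?L = "PiM I (\<lambda>_. lborel) :: ('a \<Rightarrow> real) measure"
  interpret L: product_sigma_finite "\<lambda>_::'a. lborel :: real measure" by (rule product_sigma_finite_lborel)
  interpret LI: finite_product_sigma_finite "\<lambda>_::'a. lborel :: real measure" I by standard (rule I)
  interpret P: pair_sigma_finite ?L "lborel :: real measure" ..
  have [measurable]: "f \<in> borel_measurable ?L" using f by (simp add: measurable_def sets_gauss space_PiM)
  have [measurable]: "dir_coord I d \<in> borel_measurable ?L" unfolding dir_coord_def by measurable
  have [measurable]: "(\<lambda>p. shift_along I d (h p) (g p)) \<in> measurable M ?L"
    if [measurable]: "h \<in> borel_measurable M" and g: "g \<in> measurable M ?L" for h g and M :: "'z measure"
  proof -
    have [measurable]: "(\<lambda>p. g p a) \<in> borel_measurable M" if "a \<in> I" for a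
      using measurable_compose[OF g measurable_component_singleton[OF that]] by simp
    show ?thesis unfolding shift_along_def by measurable
  qed
  define n where "n x = ennreal (std_normal_density x)" for x
  define G where "G \<omega> = (\<Prod>i\<in>I. n (\<omega> i))" for \<omega> :: "'a \<Rightarrow> real"
  have [measurable]: "n \<in> borel_measurable borel" unfolding n_def by measurable
  have [measurable]: "G \<in> borel_measurable ?L" unfolding G_def by measurable
  have G_eq: "G \<omega> = ennreal ((1 / sqrt (2 * pi)) ^ card I * exp (- (\<Sum>i\<in>I. (\<omega> i)\<^sup>2) / 2))" for \<omega>
    unfolding G_def n_def std_normal_density_def
    by (simp add: prod_ennreal prod_dividef power_one_over exp_sum[OF I] sum_divide_distrib
        flip: sum_negf)
  \<comment> \<open>The exponents match because \<open>d\<close> is a unit vector: |w - x d|^2 + <d,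
    w>^2 = |w|^2 + (x - <d, w>)^2.\<close>
  have key: "n (dir_coord I d \<omega>) * G (shift_along I d (-x) \<omega>) = G \<omega> * n (x - dir_coord I d \<omega>)" for \<omega> x
  proof -
    have "(\<Sum>i\<in>I. (shift_along I d (-x) \<omega> i)\<^sup>2) = (\<Sum>i\<in>I. (\<omega> i)\<^sup>2 - 2 * x * (d i * \<omega> i) + x\<^sup>2 * (d i)\<^sup>2)"
      by (intro sum.cong) (auto simp: shift_along_def power2_eq_square algebra_simps)
    also have "\<dots> = (\<Sum>i\<in>I. (\<omega> i)\<^sup>2) - 2 * x * dir_coord I d \<omega> + x\<^sup>2"
      by (simp add: sum.distrib sum_subtractf dir_coord_def d flip: sum_distrib_left)
    finally have "(\<Sum>i\<in>I. (shift_along I d (-x) \<omega> i)\<^sup>2) + (dir_coord I d \<omega>)\<^sup>2 = (\<Sum>i\<in>I. (\<omega> i)\<^sup>2) + (x - dir_coord I d \<omega>)\<^sup>2"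
      by (simp add: power2_eq_square algebra_simps)
    then have e: "- (dir_coord I d \<omega>)\<^sup>2 / 2 + - (\<Sum>i\<in>I. (shift_along I d (-x) \<omega> i)\<^sup>2) / 2
       = - (\<Sum>i\<in>I. (\<omega> i)\<^sup>2) / 2 + - (x - dir_coord I d \<omega>)\<^sup>2 / 2" by linarith
    show ?thesis
      unfolding G_eq n_def std_normal_density_def
      using arg_cong[OF e, of exp] unfolding exp_add
      by (simp flip: ennreal_mult add: mult_ac)
  qed
  have dens: "integral\<^sup>N (gauss I) h = (\<integral>\<^sup>+\<omega>. G \<omega> * h \<omega> \<partial>?L)" if "h \<in> borel_measurable ?L" for h
    unfolding gauss_eq_density[OF I] using that
    by (subst nn_integral_density) (auto simp: G_def n_def)
  have densN: "integral\<^sup>N std_normal h = (\<integral>\<^sup>+x. n x * h x \<partial>lborel)" if "h \<in> borel_measurable borel" for h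
    unfolding n_def using that by (subst nn_integral_density) auto
  have n1: "(\<integral>\<^sup>+x. n (x - z) \<partial>lborel) = 1" for z
  proof -
    have "(\<integral>\<^sup>+x. n (x - z) \<partial>lborel) = (\<integral>\<^sup>+x. n x \<partial>lborel)"
      by (subst nn_integral_real_affine[where t=z and c=1]) auto
    also have "\<dots> = emeasure std_normal UNIV"
      by (simp add: emeasure_density n_def)
    also have "\<dots> = 1" using prob_space.emeasure_space_1[OF prob_space_std_normal] by simp
    finally show ?thesis .
  qed
  have "(\<integral>\<^sup>+\<omega>. \<integral>\<^sup>+x. f (shift_along I d (x - dir_coord I d \<omega>) \<omega>) \<partial>std_normal \<partial>gauss I)
      = (\<integral>\<^sup>+\<omega>. \<integral>\<^sup>+x. n x * f (shift_along I d (x - dir_coord I d \<omega>) \<omega>) \<partial>lborel \<partial>gauss I)"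
    by (intro nn_integral_cong densN) (auto simp: space_PiM intro!: measurable_compose[OF _ \<open>f \<in> borel_measurable ?L\<close>] measurable_PiM_single' simp: shift_along_def)
  also have "\<dots> = (\<integral>\<^sup>+\<omega>. G \<omega> * (\<integral>\<^sup>+x. n x * f (shift_along I d (x - dir_coord I d \<omega>) \<omega>) \<partial>lborel) \<partial>?L)"
    by (rule dens) measurable
  also have "\<dots> = (\<integral>\<^sup>+\<omega>. (\<integral>\<^sup>+x. G \<omega> * (n x * f (shift_along I d (x - dir_coord I d \<omega>) \<omega>)) \<partial>lborel) \<partial>?L)"
    by (intro nn_integral_cong nn_integral_cmult[symmetric]) measurable
  \<comment> \<open>First shear: for fixed \<open>\<omega>\<close>, translate \<open>x\<close> by
    \<open>dir_coord I d \<omega>\<close>.\<close>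
  also have "\<dots> = (\<integral>\<^sup>+\<omega>. (\<integral>\<^sup>+x. G \<omega> * (n (x + dir_coord I d \<omega>) * f (shift_along I d x \<omega>)) \<partial>lborel) \<partial>?L)"
    (is "_ = (\<integral>\<^sup>+\<omega>. ?J \<omega> \<partial>?L)")
  proof (rule nn_integral_cong)
    fix \<omega> assume w: "\<omega> \<in> space ?L"
    have "(\<lambda>x. G \<omega> * (n x * f (shift_along I d (x - dir_coord I d \<omega>) \<omega>))) \<in> borel_measurable borel"
      using w by measurable
    then show "(\<integral>\<^sup>+x. G \<omega> * (n x * f (shift_along I d (x - dir_coord I d \<omega>) \<omega>)) \<partial>lborel) = ?J \<omega>"
      by (subst nn_integral_real_affine[where t="dir_coord I d \<omega>" and c=1]) (auto simp: add.commute)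
  qed
  also have "\<dots> = (\<integral>\<^sup>+x. (\<integral>\<^sup>+\<omega>. G \<omega> * (n (x + dir_coord I d \<omega>) * f (shift_along I d x \<omega>)) \<partial>?L) \<partial>lborel)"
    by (rule P.Fubini'[symmetric]) measurable
  \<comment> \<open>Second shear: for fixed \<open>x\<close>, translate \<open>\<omega>\<close> by
    \<open>-x\<close> times \<open>d\<close>.\<close>
  also have "\<dots> = (\<integral>\<^sup>+x. (\<integral>\<^sup>+\<omega>. G (shift_along I d (-x) \<omega>) * (n (dir_coord I d \<omega>) * f \<omega>) \<partial>?L) \<partial>lborel)"
  proof (rule nn_integral_cong)
    fix x :: real
    let ?H = "\<lambda>\<omega>. G \<omega> * (n (x + dir_coord I d \<omega>) * f (shift_along I d x \<omega>))"
    have "(\<integral>\<^sup>+\<omega>. ?H \<omega> \<partial>?L) = (\<integral>\<^sup>+\<omega>. ?H (shift_along I d (-x) \<omega>) \<partial>?L)"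
      by (rule nn_integral_PiM_lborel_shift[OF I, symmetric]) measurable
    also have "\<dots> = (\<integral>\<^sup>+\<omega>. G (shift_along I d (-x) \<omega>) * (n (dir_coord I d \<omega>) * f \<omega>) \<partial>?L)"
    proof (rule nn_integral_cong)
      fix \<omega> :: "'a \<Rightarrow> real" assume "\<omega> \<in> space ?L"
      then have "shift_along I d x (shift_along I d (-x) \<omega>) = \<omega>"
        by (auto simp: shift_along_def space_PiM PiE_iff extensional_def fun_eq_iff)
      moreover have "x + dir_coord I d (shift_along I d (-x) \<omega>) = dir_coord I d \<omega>"
        using d by (simp add: dir_coord_shift power2_eq_square)
      ultimately show "?H (shift_along I d (-x) \<omega>) = G (shift_along I d (-x) \<omega>) * (n (dir_coord I d \<omega>) * f \<omega>)" by simp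
    qed
    finally show "(\<integral>\<^sup>+\<omega>. ?H \<omega> \<partial>?L) = (\<integral>\<^sup>+\<omega>. G (shift_along I d (-x) \<omega>) * (n (dir_coord I d \<omega>) * f \<omega>) \<partial>?L)" .
  qed
  \<comment> \<open>After \<open>key\<close>, the variable \<open>x\<close> occurs only in a
    translated normal density, whose total mass is 1 by \<open>n1\<close>.\<close>
  also have "\<dots> = (\<integral>\<^sup>+x. (\<integral>\<^sup>+\<omega>. (G \<omega> * f \<omega>) * n (x - dir_coord I d \<omega>) \<partial>?L) \<partial>lborel)"
    by (intro nn_integral_cong) (metis key mult.assoc mult.commute)
  also have "\<dots> = (\<integral>\<^sup>+\<omega>. (\<integral>\<^sup>+x. (G \<omega> * f \<omega>) * n (x - dir_coord I d \<omega>) \<partial>lborel) \<partial>?L)"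
    by (rule P.Fubini') measurable
  also have "\<dots> = (\<integral>\<^sup>+\<omega>. G \<omega> * f \<omega> \<partial>?L)"
    by (intro nn_integral_cong) (simp add: nn_integral_cmult n1)
  also have "\<dots> = (\<integral>\<^sup>+\<omega>. f \<omega> \<partial>gauss I)"
    by (rule dens[symmetric]) measurable
  finally show ?thesis by simp
qed

section \<open>Fractional moments of affine functions of Gaussians\<close>

text \<open>Values in \<open>ennreal\<close> send 0 to \<open>\<top>\<close>. Hence a finite
  integral of \<open>inv_sqrt (f \<omega>)\<close> times a positive factor forces \<open>f\<close>
  to be nonzero almost everywhere.\<close>

definition inv_sqrt :: "real \<Rightarrow> ennreal" where
  "inv_sqrt y = inverse (ennreal (sqrt \<bar>y\<bar>))"

text \<open>The weight dominates sqrt |x|, so it absorbs square roots of monomials; being at least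
  1, it may be inserted as a surplus factor in upper bounds.\<close>

definition wt :: "real \<Rightarrow> real" where
  "wt x = max 1 (sqrt \<bar>x\<bar>)"

lemma measurable_inv_sqrt [measurable]: "inv_sqrt \<in> borel_measurable borel"
  unfolding inv_sqrt_def by measurable

lemma measurable_wt [measurable]: "wt \<in> borel_measurable borel"
  unfolding wt_def by measurable

lemma wt_ge_1: "1 \<le> wt x" and sqrt_le_wt: "sqrt \<bar>x\<bar> \<le> wt x"
  by (auto simp: wt_def)

lemma inv_sqrt_0 [simp]: "inv_sqrt 0 = \<top>"
  by (simp add: inv_sqrt_def)

lemma inv_sqrt_nonzero: "y \<noteq> 0 \<Longrightarrow> inv_sqrt y = ennreal (1 / sqrt \<bar>y\<bar>)"
  by (simp add: inv_sqrt_def inverse_ennreal inverse_eq_divide)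

lemma inv_sqrt_mult: "a \<noteq> 0 \<Longrightarrow> inv_sqrt (a * y) = inv_sqrt a * inv_sqrt y"
  by (cases "y = 0")
     (auto simp: inv_sqrt_nonzero abs_mult real_sqrt_mult ennreal_mult_top simp flip: ennreal_mult)

lemma sqrt_mult_inv_sqrt_le: "ennreal (sqrt \<bar>y\<bar>) * inv_sqrt y \<le> 1"
  by (cases "y = 0") (auto simp: inv_sqrt_nonzero simp flip: ennreal_mult ennreal_1)

section \<open>One-dimensional Gaussian integrals with an inverse square root singularity\<close>

lemma nn_integral_inv_sqrt_near_0:
  "(\<integral>\<^sup>+u. inv_sqrt u * indicator {-1..1} u \<partial>lborel) \<le> 4"
proof -
  let ?g = "\<lambda>u. inv_sqrt u * indicator {0..1} u"
  have "((\<lambda>x::real. x powr (-1/2)) has_integral (1 powr (-1/2 + 1) / (-1/2 + 1))) {0..1}"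
    by (rule has_integral_powr_from_0) auto
  then have "(\<integral>\<^sup>+u. ennreal (u powr (-1/2)) * indicator {0..1} u \<partial>lborel) = ennreal 2"
    using nn_integral_has_integral_lebesgue'[of "{0..1::real}" "\<lambda>x. x powr (-1/2)"] by simp
  moreover have "(\<integral>\<^sup>+u. ?g u \<partial>lborel) = (\<integral>\<^sup>+u. ennreal (u powr (-1/2)) * indicator {0..1} u \<partial>lborel)"
  \<comment> \<open>The integrands differ at 0, where \<open>inv_sqrt\<close> is
    \<open>\<top>\<close> and \<open>powr\<close> gives 0; a single point is a null set.\<close>
  proof (rule nn_integral_cong_AE, rule AE_mp[OF AE_lborel_singleton[of 0]], rule AE_I2, rule impI)
    fix u :: real assume "u \<noteq> 0"
    then show "?g u = ennreal (u powr (-1/2)) * indicator {0..1} u"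
      by (auto simp: indicator_def inv_sqrt_nonzero powr_minus_divide powr_half_sqrt)
  qed
  ultimately have g: "(\<integral>\<^sup>+u. ?g u \<partial>lborel) = 2" by simp
  then have g': "(\<integral>\<^sup>+u. ?g (-u) \<partial>lborel) = 2"
    by (subst (asm) nn_integral_real_affine[where t=0 and c="-1"]) auto
  have "(\<integral>\<^sup>+u. inv_sqrt u * indicator {-1..1} u \<partial>lborel) \<le> (\<integral>\<^sup>+u. ?g u + ?g (-u) \<partial>lborel)"
    by (intro nn_integral_mono) (auto simp: indicator_def inv_sqrt_def)
  also have "\<dots> = 4" by (subst nn_integral_add) (auto simp: g g')
  finally show ?thesis .
qed

lemma abs_le_1_plus_square: "\<bar>x\<bar> \<le> 1 + x\<^sup>2" for x :: real
proof -
  have "0 \<le> (\<bar>x\<bar> - 1/2)\<^sup>2" by simp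
  also have "\<dots> = x\<^sup>2 - \<bar>x\<bar> + 1/4" by (simp add: power2_eq_square algebra_simps)
  finally show ?thesis by simp
qed

text \<open>Both arguments of the maximum in \<open>wt x\<close> are at most exp (x^2 / 2), which
  the Gaussian exponential cancels; what is left is 1 / sqrt (2 pi) \<le> 1/2.\<close>

lemma wt_std_normal_density_le: "std_normal_density x * wt x \<le> 1/2"
proof -
  have "\<bar>x\<bar> \<le> 1 + x\<^sup>2" by (rule abs_le_1_plus_square)
  also have "\<dots> \<le> exp (x\<^sup>2)" by (simp add: exp_ge_add_one_self)
  also have "\<dots> = (exp (x\<^sup>2 / 2))\<^sup>2" by (simp flip: exp_double)
  finally have "sqrt \<bar>x\<bar> \<le> exp (x\<^sup>2 / 2)" by (simp add: real_le_lsqrt)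
  then have "wt x \<le> exp (x\<^sup>2 / 2)" by (simp add: wt_def)
  then have "exp (- x\<^sup>2 / 2) * wt x \<le> exp (- x\<^sup>2 / 2) * exp (x\<^sup>2 / 2)"
    by (intro mult_left_mono) auto
  also have "\<dots> = 1" by (simp flip: exp_add)
  finally have 1: "exp (- x\<^sup>2 / 2) * wt x \<le> 1" .
  have "2 \<le> sqrt (2 * pi)" using pi_gt3 by (intro real_le_rsqrt) auto
  then have "1 / sqrt (2 * pi) \<le> 1/2" by (simp add: field_simps)
  from mult_mono[OF this 1] show ?thesis
    unfolding std_normal_density_def by (simp add: mult_ac wt_def)
qed

lemma nn_integral_std_normal_1_plus_square:
  "(\<integral>\<^sup>+x. ennreal (std_normal_density x * (1 + x\<^sup>2)) \<partial>lborel) = 2"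
proof -
  have "has_bochner_integral lborel (\<lambda>x. std_normal_density x * x ^ (2 * 1)) (fact (2 * 1) / (2 ^ 1 * fact 1))"
    by (rule std_normal_moment_even)
  then have 2: "has_bochner_integral lborel (\<lambda>x. std_normal_density x * x\<^sup>2) 1" by simp
  have 1: "has_bochner_integral lborel std_normal_density 1"
    by (simp add: has_bochner_integral_iff)
  from has_bochner_integral_add[OF 1 2]
  have "has_bochner_integral lborel (\<lambda>x. std_normal_density x * (1 + x\<^sup>2)) 2"
    by (simp add: distrib_left)
  then have "(\<integral>\<^sup>+x. ennreal (std_normal_density x * (1 + x\<^sup>2)) \<partial>lborel) = ennreal 2"
    by (subst nn_integral_eq_integrable) (auto simp: has_bochner_integral_iff)
  then show ?thesis by simp
qed

text \<open>After factoring out \<open>a\<close>, the integral is split at distance 1 from the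
  singularity. Far away \<open>inv_sqrt\<close> is at most 1 and \<open>wt x\<close> at most 1 +
  x^2, which contributes 2. Nearby the weighted density is at most 1/2 and the singularity
  integrates to at most 4, which contributes 2 again. The bound is uniform in the offset
  \<open>b\<close>; for \<open>a = 0\<close> the right-hand side is infinite.\<close>

lemma nn_integral_wt_inv_sqrt_affine:
  "(\<integral>\<^sup>+x. ennreal (wt x) * inv_sqrt (b + x * a) \<partial>std_normal) \<le> 4 * inv_sqrt a"
proof (cases "a = 0")
  case True
  then show ?thesis by (simp add: ennreal_mult_top)
next
  case False
  define c where "c = b / a"
  let ?n = "\<lambda>x. ennreal (std_normal_density x)"
  have pw: "?n x * (ennreal (wt x) * inv_sqrt (x + c)) \<le> ennreal (std_normal_density x * (1 + x\<^sup>2))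
      + ennreal (1/2) * (inv_sqrt (c + 1 * x) * indicator {-1..1} (c + 1 * x))" for x
  proof (cases "\<bar>x + c\<bar> \<le> 1")
    case True
    have "?n x * (ennreal (wt x) * inv_sqrt (x + c)) = ennreal (std_normal_density x * wt x) * inv_sqrt (x + c)"
      by (simp add: ennreal_mult' mult.assoc)
    also have "\<dots> \<le> ennreal (1/2) * inv_sqrt (x + c)"
      by (intro mult_right_mono ennreal_leI wt_std_normal_density_le) auto
    also have "\<dots> = ennreal (1/2) * (inv_sqrt (c + 1 * x) * indicator {-1..1} (c + 1 * x))"
      using True by (simp add: add.commute abs_le_iff indicator_def)
    finally show ?thesis by (simp add: add_increasing)
  next
    case False
    have "inv_sqrt (x + c) \<le> 1"
      using False by (subst inv_sqrt_nonzero) (auto simp: divide_le_eq_1)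
    moreover have "wt x \<le> 1 + x\<^sup>2"
    proof -
      have "sqrt \<bar>x\<bar> \<le> 1 + x\<^sup>2"
        using abs_le_1_plus_square[of x] self_le_power[of "1 + x\<^sup>2" 2]
        by (intro real_le_lsqrt) auto
      then show ?thesis by (simp add: wt_def)
    qed
    ultimately have "ennreal (wt x) * inv_sqrt (x + c) \<le> ennreal (1 + x\<^sup>2) * 1"
      by (intro mult_mono ennreal_leI) auto
    then have "?n x * (ennreal (wt x) * inv_sqrt (x + c)) \<le> ?n x * ennreal (1 + x\<^sup>2)"
      by (intro mult_left_mono) auto
    then show ?thesis by (simp add: ennreal_mult' add_increasing2)
  qed
  have "(\<integral>\<^sup>+x. ennreal (wt x) * inv_sqrt (b + x * a) \<partial>std_normal)
      = (\<integral>\<^sup>+x. inv_sqrt a * (ennreal (wt x) * inv_sqrt (x + c)) \<partial>std_normal)"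
  proof (intro nn_integral_cong)
    fix x
    have "b + x * a = a * (x + c)" using False by (simp add: c_def field_simps)
    then show "ennreal (wt x) * inv_sqrt (b + x * a) = inv_sqrt a * (ennreal (wt x) * inv_sqrt (x + c))"
      using False by (simp add: inv_sqrt_mult mult_ac)
  qed
  also have "\<dots> = inv_sqrt a * (\<integral>\<^sup>+x. ennreal (wt x) * inv_sqrt (x + c) \<partial>std_normal)"
    by (rule nn_integral_cmult) measurable
  finally have scale: "(\<integral>\<^sup>+x. ennreal (wt x) * inv_sqrt (b + x * a) \<partial>std_normal)
      = inv_sqrt a * (\<integral>\<^sup>+x. ennreal (wt x) * inv_sqrt (x + c) \<partial>std_normal)" .
  have half: "2 + ennreal (1/2) * 4 = 4"
  proof -
    have "ennreal (1/2) * 4 = ennreal (1/2) * ennreal 4" by simp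
    also have "\<dots> = ennreal 2" by (subst ennreal_mult[symmetric]) auto
    finally show ?thesis by simp
  qed
  have near: "(\<integral>\<^sup>+x. inv_sqrt (c + 1 * x) * indicator {-1..1} (c + 1 * x) \<partial>lborel) \<le> 4"
    using nn_integral_inv_sqrt_near_0
    by (subst (asm) nn_integral_real_affine[where t=c and c=1]) auto
  have "(\<integral>\<^sup>+x. ennreal (wt x) * inv_sqrt (x + c) \<partial>std_normal)
      = (\<integral>\<^sup>+x. ?n x * (ennreal (wt x) * inv_sqrt (x + c)) \<partial>lborel)"
    by (rule nn_integral_density) measurable
  also have "\<dots> \<le> (\<integral>\<^sup>+x. ennreal (std_normal_density x * (1 + x\<^sup>2))
      + ennreal (1/2) * (inv_sqrt (c + 1 * x) * indicator {-1..1} (c + 1 * x)) \<partial>lborel)"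
    by (intro nn_integral_mono pw)
  also have "\<dots> = (\<integral>\<^sup>+x. ennreal (std_normal_density x * (1 + x\<^sup>2)) \<partial>lborel)
      + (\<integral>\<^sup>+x. ennreal (1/2) * (inv_sqrt (c + 1 * x) * indicator {-1..1} (c + 1 * x)) \<partial>lborel)"
    by (rule nn_integral_add) measurable
  also have "\<dots> = 2 + ennreal (1/2) * (\<integral>\<^sup>+x. inv_sqrt (c + 1 * x) * indicator {-1..1} (c + 1 * x) \<partial>lborel)"
    unfolding nn_integral_std_normal_1_plus_square
    by (intro arg_cong2[of _ _ _ _ "(+)"] refl nn_integral_cmult) measurable
  also have "\<dots> \<le> 2 + ennreal (1/2) * 4"
    by (intro add_mono mult_left_mono near) auto
  finally show ?thesis
    unfolding half scale by (simp add: mult.commute mult_left_mono)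
qed

text \<open>Integrating out the directions \<open>d i\<close> one at a time: each step replaces \<open>F S\<close> by its slope
  in a new direction, at the cost of a factor 4.\<close>

lemma gauss_fractional_moment:
  fixes d :: "'i \<Rightarrow> 'a \<Rightarrow> real" and F :: "'i set \<Rightarrow> ('a \<Rightarrow> real) \<Rightarrow> real"
  assumes I: "finite I" and P: "finite P"
    and orth: "\<And>i j. i \<in> P \<Longrightarrow> j \<in> P \<Longrightarrow> (\<Sum>a\<in>I. d i a * d j a) = (if i = j then 1 else 0)"
    and meas: "\<And>S. S \<subseteq> P \<Longrightarrow> F S \<in> borel_measurable (gauss I)"
    and aff: "\<And>S i x \<omega>. S \<subseteq> P \<Longrightarrow> i \<in> P - S \<Longrightarrow>
      F S (shift_along I (d i) x \<omega>) = F S \<omega> + x * F (insert i S) \<omega>"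
    and inv: "\<And>i x \<omega>. i \<in> P \<Longrightarrow> F P (shift_along I (d i) x \<omega>) = F P \<omega>"
  shows "(\<integral>\<^sup>+\<omega>. ennreal (sqrt \<bar>F P \<omega>\<bar> * (\<Prod>i\<in>P. wt (dir_coord I (d i) \<omega>))) * inv_sqrt (F {} \<omega>) \<partial>gauss I)
    \<le> 4 ^ card P"
proof -
  define z where "z i = dir_coord I (d i)" for i
  have [measurable]: "z i \<in> borel_measurable (gauss I)" for i
    unfolding z_def dir_coord_def by measurable
  have [measurable]: "F P \<in> borel_measurable (gauss I)" by (rule meas) simp
  \<comment> \<open>\<open>Q\<close> holds the directions still to be integrated out:
    \<open>J P\<close> is the integral to be bounded, while in \<open>J {}\<close> the two
    occurrences of \<open>F P\<close> cancel.\<close>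
  define J where "J Q = (\<integral>\<^sup>+\<omega>. ennreal (sqrt \<bar>F P \<omega>\<bar> * (\<Prod>i\<in>Q. wt (z i \<omega>))) * inv_sqrt (F (P - Q) \<omega>) \<partial>gauss I)" for Q
  have "J Q \<le> 4 ^ card Q" if "Q \<subseteq> P" for Q
    using finite_subset[OF that P] that
  proof (induction Q rule: finite_induct)
    case empty
    have "J {} \<le> (\<integral>\<^sup>+\<omega>. 1 \<partial>gauss I)"
      unfolding J_def by (intro nn_integral_mono) (simp add: sqrt_mult_inv_sqrt_le)
    also have "\<dots> = 1" using prob_space.emeasure_space_1[OF prob_space_gauss, of I] by simp
    finally show ?case by simp
  next
    case (insert i Q)
    then have iP: "i \<in> P" and QP: "Q \<subseteq> P" by auto
    have [measurable]: "F (P - insert i Q) \<in> borel_measurable (gauss I)"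
      "F (P - Q) \<in> borel_measurable (gauss I)" by (auto intro: meas)
    have ins: "insert i (P - insert i Q) = P - Q" using insert.hyps iP by auto
    define u where "u \<omega> = sqrt \<bar>F P \<omega>\<bar> * (\<Prod>i\<in>Q. wt (z i \<omega>))" for \<omega>
    have [measurable]: "u \<in> borel_measurable (gauss I)" unfolding u_def by measurable
    have u0: "u \<omega> \<ge> 0" for \<omega> unfolding u_def by (intro mult_nonneg_nonneg prod_nonneg) (auto simp: wt_def)
    have z_other: "z j (shift_along I (d i) x \<omega>) = z j \<omega>" if "j \<in> Q" for j x \<omega>
    proof -
      have "j \<noteq> i" "j \<in> P" using that QP insert.hyps by auto
      then show ?thesis using orth[of j i] iP by (simp add: z_def dir_coord_shift)
    qed
    have z_self: "z i (shift_along I (d i) x \<omega>) = z i \<omega> + x" for x \<omega>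
      using orth[OF iP iP] by (simp add: z_def dir_coord_shift)
    \<comment> \<open>By orthogonality \<open>u\<close> is constant along \<open>d i\<close>. After
      resampling it leaves the inner integral, where one weight and the inverse root of an affine
      function of \<open>x\<close> with slope \<open>F (P - Q) \<omega>\<close> remain.\<close>
    have u_inv: "u (shift_along I (d i) x \<omega>) = u \<omega>" for x \<omega>
      by (simp add: u_def inv[OF iP] z_other)
    have "J (insert i Q) = (\<integral>\<^sup>+\<omega>. ennreal (u \<omega> * wt (z i \<omega>)) * inv_sqrt (F (P - insert i Q) \<omega>) \<partial>gauss I)"
      unfolding J_def u_def using insert.hyps by (simp add: mult_ac)
    also have "\<dots> = (\<integral>\<^sup>+\<omega>. \<integral>\<^sup>+x. ennreal (u \<omega> * wt x)
        * inv_sqrt (F (P - insert i Q) \<omega> + (x - z i \<omega>) * F (P - Q) \<omega>) \<partial>std_normal \<partial>gauss I)"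
      using orth[OF iP iP] aff[of "P - insert i Q" i] iP
      by (subst gauss_resample[OF I, of "d i"])
         (auto simp: u_inv z_self ins power2_eq_square simp flip: z_def)
    also have "\<dots> \<le> (\<integral>\<^sup>+\<omega>. 4 * (ennreal (u \<omega>) * inv_sqrt (F (P - Q) \<omega>)) \<partial>gauss I)"
    proof (rule nn_integral_mono)
      fix \<omega>
      let ?b = "F (P - insert i Q) \<omega> - z i \<omega> * F (P - Q) \<omega>"
      have "(\<integral>\<^sup>+x. ennreal (u \<omega> * wt x)
          * inv_sqrt (F (P - insert i Q) \<omega> + (x - z i \<omega>) * F (P - Q) \<omega>) \<partial>std_normal)
        = (\<integral>\<^sup>+x. ennreal (u \<omega>) * (ennreal (wt x) * inv_sqrt (?b + x * F (P - Q) \<omega>)) \<partial>std_normal)"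
      proof (rule nn_integral_cong)
        fix x
        have "F (P - insert i Q) \<omega> + (x - z i \<omega>) * F (P - Q) \<omega> = ?b + x * F (P - Q) \<omega>"
          by (simp add: algebra_simps)
        then show "ennreal (u \<omega> * wt x) * inv_sqrt (F (P - insert i Q) \<omega> + (x - z i \<omega>) * F (P - Q) \<omega>)
          = ennreal (u \<omega>) * (ennreal (wt x) * inv_sqrt (?b + x * F (P - Q) \<omega>))"
          by (simp only: ennreal_mult'[OF u0] mult.assoc)
      qed
      also have "\<dots> = ennreal (u \<omega>) * (\<integral>\<^sup>+x. ennreal (wt x) * inv_sqrt (?b + x * F (P - Q) \<omega>) \<partial>std_normal)"
        by (rule nn_integral_cmult) measurable
      also have "\<dots> \<le> ennreal (u \<omega>) * (4 * inv_sqrt (F (P - Q) \<omega>))"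
        by (intro mult_left_mono nn_integral_wt_inv_sqrt_affine) auto
      finally show "(\<integral>\<^sup>+x. ennreal (u \<omega> * wt x)
          * inv_sqrt (F (P - insert i Q) \<omega> + (x - z i \<omega>) * F (P - Q) \<omega>) \<partial>std_normal)
          \<le> 4 * (ennreal (u \<omega>) * inv_sqrt (F (P - Q) \<omega>))"
        by (simp add: mult_ac)
    qed
    also have "\<dots> = 4 * J Q"
      unfolding J_def u_def by (rule nn_integral_cmult) measurable
    also have "\<dots> \<le> 4 * 4 ^ card Q" using insert.IH[OF QP] by (rule mult_left_mono) simp
    finally show ?case using insert.hyps by simp
  qed
  from this[of P] show ?thesis by (simp add: J_def z_def)
qed

section \<open>Determinants as functions of their rows\<close>

text \<open>With the rows given as a function, the update \<open>A(j := w)\<close> replaces a row,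
  which is the operation used throughout.\<close>

definition rdet :: "nat \<Rightarrow> (nat \<Rightarrow> nat \<Rightarrow> real) \<Rightarrow> real" where
  "rdet k A = Determinant.det (mat k k (\<lambda>(i, c). A i c))"

definition unit_row :: "nat \<Rightarrow> nat \<Rightarrow> real" where
  "unit_row c d = (if d = c then 1 else 0)"

lemma rdet_cong:
  assumes "\<And>i c. i < k \<Longrightarrow> c < k \<Longrightarrow> A i c = B i c"
  shows "rdet k A = rdet k B"
  unfolding rdet_def using assms by (intro arg_cong[of _ _ Determinant.det] cong_mat) auto

lemma rdet_leibniz:
  "rdet k A = (\<Sum>p | p permutes {0..<k}. signof p * (\<Prod>i\<in>{0..<k}. A i (p i)))"
  unfolding rdet_def
  by (subst det_def'[of _ k])
     (auto intro!: sum.cong prod.cong arg_cong2[of _ _ _ _ "(*)"] dest: permutes_in_image)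

text \<open>Each Leibniz term contains exactly one entry of row \<open>j\<close>, so linearity in
  that row can be read off.\<close>

lemma rdet_row_expand:
  assumes "j < k"
  shows "rdet k (A(j := w)) =
    (\<Sum>p | p permutes {0..<k}. signof p * (\<Prod>i\<in>{0..<k}-{j}. A i (p i)) * w (p j))"
  unfolding rdet_leibniz using assms
  by (intro sum.cong refl) (simp add: prod.remove[of "{0..<k}" j] mult_ac)

lemma rdet_row_linear:
  assumes "j < k"
  shows "rdet k (A(j := \<lambda>c. x * u c + v c)) = x * rdet k (A(j := u)) + rdet k (A(j := v))"
  unfolding rdet_row_expand[OF assms] by (simp add: algebra_simps sum.distrib sum_distrib_left)

lemma rdet_row_sum:
  assumes "j < k"
  shows "rdet k (A(j := \<lambda>c. \<Sum>s\<in>S. x s * u s c)) = (\<Sum>s\<in>S. x s * rdet k (A(j := u s)))"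
  unfolding rdet_row_expand[OF assms]
  by (simp add: sum_distrib_left mult.left_commute) (subst sum.swap, simp add: mult_ac)

lemma rdet_identical_rows:
  assumes "i < k" "j < k" "i \<noteq> j" "\<And>c. c < k \<Longrightarrow> A i c = A j c"
  shows "rdet k A = 0"
  unfolding rdet_def
  by (rule det_identical_rows[of _ k i j]) (use assms in \<open>auto intro!: eq_vecI\<close>)

text \<open>Multilinear expansion: \<open>T\<close> records the rows of \<open>J\<close> in which
  the first summand is chosen. The induction moves the chosen summand of one row into
  \<open>G\<close>, so \<open>G\<close> has to vary.\<close>

lemma rdet_expand:
  assumes "finite J" "J \<subseteq> {..<k}"
  shows "rdet k (\<lambda>i. if i \<in> J then (\<lambda>c. z i * A i c + B i c) else G i) =
    (\<Sum>T\<in>Pow J. (\<Prod>i\<in>T. z i) * rdet k (\<lambda>i. if i \<in> T then A i else if i \<in> J then B i else G i))"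
  using assms
proof (induction J arbitrary: G rule: finite_induct)
  case empty
  then show ?case by simp
next
  case (insert j J)
  let ?h = "\<lambda>J G T. rdet k (\<lambda>i. if i \<in> T then A i else if i \<in> J then B i else G i)"
  let ?M = "\<lambda>G i. if i \<in> J then (\<lambda>c. z i * A i c + B i c) else G i"
  have j: "j < k" "J \<subseteq> {..<k}" using insert.prems by auto
  have upd: "(?M G)(j := w) = ?M (G(j := w))" for w
    using insert.hyps by (auto simp: fun_eq_iff)
  have "rdet k (\<lambda>i. if i \<in> insert j J then (\<lambda>c. z i * A i c + B i c) else G i)
      = rdet k ((?M G)(j := \<lambda>c. z j * A j c + B j c))"
    by (rule arg_cong[of _ _ "rdet k"]) (auto simp: fun_eq_iff)
  also have "\<dots> = z j * rdet k (?M (G(j := A j))) + rdet k (?M (G(j := B j)))"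
    using rdet_row_linear[OF j(1), of "?M G" "z j" "A j" "B j"] unfolding upd by simp
  also have "\<dots> = (\<Sum>T\<in>Pow J. z j * (\<Prod>i\<in>T. z i) * ?h J (G(j := A j)) T)
      + (\<Sum>T\<in>Pow J. (\<Prod>i\<in>T. z i) * ?h J (G(j := B j)) T)"
    unfolding insert.IH[OF j(2)] by (simp add: sum_distrib_left mult.assoc)
  also have "(\<Sum>T\<in>Pow J. (\<Prod>i\<in>T. z i) * ?h J (G(j := B j)) T)
      = (\<Sum>T\<in>Pow J. (\<Prod>i\<in>T. z i) * ?h (insert j J) G T)"
    using insert.hyps by (intro sum.cong refl arg_cong2[of _ _ _ _ "(*)"] rdet_cong) auto
  also have "(\<Sum>T\<in>Pow J. z j * (\<Prod>i\<in>T. z i) * ?h J (G(j := A j)) T)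
      = (\<Sum>T\<in>insert j ` Pow J. (\<Prod>i\<in>T. z i) * ?h (insert j J) G T)"
  proof (subst sum.reindex)
    show "inj_on (insert j) (Pow J)" using insert.hyps by (auto simp: inj_on_def)
    show "(\<Sum>T\<in>Pow J. z j * (\<Prod>i\<in>T. z i) * ?h J (G(j := A j)) T)
      = sum ((\<lambda>T. (\<Prod>i\<in>T. z i) * ?h (insert j J) G T) \<circ> insert j) (Pow J)"
    proof (rule sum.cong[OF refl])
      fix T assume T: "T \<in> Pow J"
      then have "finite T" "j \<notin> T" using insert.hyps finite_subset by auto
      moreover have "?h J (G(j := A j)) T = ?h (insert j J) G (insert j T)"
        using insert.hyps T by (intro rdet_cong) auto
      ultimately show "z j * (\<Prod>i\<in>T. z i) * ?h J (G(j := A j)) T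
          = ((\<lambda>T. (\<Prod>i\<in>T. z i) * ?h (insert j J) G T) \<circ> insert j) T"
        by simp
    qed
  qed
  also have "(\<Sum>T\<in>insert j ` Pow J. (\<Prod>i\<in>T. z i) * ?h (insert j J) G T)
      + (\<Sum>T\<in>Pow J. (\<Prod>i\<in>T. z i) * ?h (insert j J) G T)
      = (\<Sum>T\<in>Pow (insert j J). (\<Prod>i\<in>T. z i) * ?h (insert j J) G T)"
    unfolding Pow_insert using insert.hyps
    by (subst sum.union_disjoint) auto
  finally show ?case .
qed

text \<open>By the pigeonhole principle no permutation maps \<open>P\<close> into \<open>R\<close>,
  so every Leibniz term has a factor 0.\<close>

lemma rdet_zero_block:
  assumes "P \<subseteq> {..<k}" "R \<subseteq> {..<k}" "card R < card P"
    and 0: "\<And>i c. i \<in> P \<Longrightarrow> c < k \<Longrightarrow> c \<notin> R \<Longrightarrow> A i c = 0"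
  shows "rdet k A = 0"
  unfolding rdet_leibniz
proof (intro sum.neutral ballI)
  fix p assume "p \<in> {p. p permutes {0..<k}}"
  then have p: "p permutes {0..<k}" by simp
  have "\<exists>i\<in>P. p i \<notin> R"
  proof (rule ccontr)
    assume "\<not> ?thesis"
    then have "p ` P \<subseteq> R" by auto
    then have "card P \<le> card R"
      using assms(2) permutes_inj_on[OF p, of P] by (metis card_inj_on_le finite_lessThan finite_subset)
    then show False using assms(3) by simp
  qed
  then obtain i where i: "i \<in> P" "p i \<notin> R" by auto
  then have "i < k" "p i < k" using assms(1) permutes_in_image[OF p, of i] by auto
  then show "signof p * (\<Prod>i\<in>{0..<k}. A i (p i)) = 0"
    using 0[OF i(1) _ i(2)] by (auto intro!: prod_zero)
qed

text \<open>A permutation with a nonzero Leibniz term must map \<open>P\<close> onto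
  \<open>R\<close>, hence the other rows to columns outside \<open>R\<close>. Entries outside
  \<open>P\<close> in columns of \<open>R\<close> therefore never contribute.\<close>

lemma rdet_block_cong:
  assumes "P \<subseteq> {..<k}" "R \<subseteq> {..<k}" "card P = card R"
    and A0: "\<And>i c. i \<in> P \<Longrightarrow> c < k \<Longrightarrow> c \<notin> R \<Longrightarrow> A i c = 0"
    and B0: "\<And>i c. i \<in> P \<Longrightarrow> c < k \<Longrightarrow> c \<notin> R \<Longrightarrow> B i c = 0"
    and eq1: "\<And>i c. i \<in> P \<Longrightarrow> c \<in> R \<Longrightarrow> A i c = B i c"
    and eq2: "\<And>i c. i < k \<Longrightarrow> i \<notin> P \<Longrightarrow> c < k \<Longrightarrow> c \<notin> R \<Longrightarrow> A i c = B i c"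
  shows "rdet k A = rdet k B"
  unfolding rdet_leibniz
proof (rule sum.cong[OF refl])
  fix p assume "p \<in> {p. p permutes {0..<k}}"
  then have p: "p permutes {0..<k}" by simp
  have pk: "p i < k" if "i < k" for i using permutes_in_image[OF p, of i] that by simp
  show "signof p * (\<Prod>i\<in>{0..<k}. A i (p i)) = signof p * (\<Prod>i\<in>{0..<k}. B i (p i))"
  proof (cases "p ` P \<subseteq> R")
    case True
    have "p ` P = R"
      using True assms(2,3) permutes_inj_on[OF p, of P]
      by (metis card_image card_subset_eq finite_lessThan finite_subset)
    then have "p i \<notin> R" if "i \<notin> P" for i
      using that permutes_inj[OF p] by (auto simp: inj_def)
    then show ?thesis
      using eq1 eq2 True pk by (intro arg_cong2[of _ _ _ _ "(*)"] prod.cong refl) fastforce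
  next
    case False
    then obtain i where i: "i \<in> P" "p i \<notin> R" by auto
    then have "i < k" "p i < k" using assms(1) pk by auto
    then have "A i (p i) = 0" "B i (p i) = 0" "i \<in> {0..<k}"
      using A0[OF i(1) _ i(2)] B0[OF i(1) _ i(2)] by auto
    then have "(\<Prod>i\<in>{0..<k}. A i (p i)) = 0" "(\<Prod>i\<in>{0..<k}. B i (p i)) = 0"
      by (meson finite_atLeastLessThan prod_zero)+
    then show ?thesis by (simp only:)
  qed
qed

section \<open>Cofactors, Cramer's rule and the norm of the inverse\<close>

lemma rdet_unit_row:
  assumes "j < k" "c < k"
  shows "rdet k (A(j := unit_row c)) = cofactor (mat k k (\<lambda>(i, c). A i c)) j c"
proof -
  define M where "M = mat k k (\<lambda>(i, d). (A(j := unit_row c)) i d)"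
  have "rdet k (A(j := unit_row c)) = (\<Sum>d<k. M $$ (j, d) * cofactor M j d)"
    unfolding rdet_def M_def by (rule laplace_expansion_row[OF _ assms(1)]) simp
  also have "\<dots> = (\<Sum>d<k. if d = c then cofactor M j c else 0)"
    using assms by (intro sum.cong) (auto simp: unit_row_def M_def)
  also have "\<dots> = cofactor M j c" using assms by simp
  also have "mat_delete M j c = mat_delete (mat k k (\<lambda>(i, c). A i c)) j c"
    unfolding mat_delete_def M_def by (intro cong_mat) auto
  then have "cofactor M j c = cofactor (mat k k (\<lambda>(i, c). A i c)) j c"
    unfolding cofactor_def by simp
  finally show ?thesis .
qed

text \<open>This is adj(A) A = det(A) 1 applied to \<open>y\<close>, with unit-row determinants as
  entries of the adjugate. Being free of division, it also covers singular matrices.\<close>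

lemma cramer_rows:
  assumes "c < k"
  shows "rdet k A * y c = (\<Sum>j<k. rdet k (A(j := unit_row c)) * (\<Sum>d<k. A j d * y d))"
proof -
  let ?A = "mat k k (\<lambda>(i, c). A i c)"
  have A: "?A \<in> carrier_mat k k" by simp
  have "(\<Sum>j<k. rdet k (A(j := unit_row c)) * A j d) = (if c = d then rdet k A else 0)" if d: "d < k" for d
  proof -
    have "(\<Sum>j<k. rdet k (A(j := unit_row c)) * A j d) = (\<Sum>j<k. adj_mat ?A $$ (c, j) * ?A $$ (j, d))"
      using assms d by (intro sum.cong) (auto simp: rdet_unit_row adj_mat_def)
    also have "\<dots> = (adj_mat ?A * ?A) $$ (c, d)"
      using assms d adj_mat(1)[OF A] by (simp add: scalar_prod_def lessThan_atLeast0)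
    also have "\<dots> = (if c = d then rdet k A else 0)"
      unfolding adj_mat(3)[OF A] using assms d by (simp add: rdet_def)
    finally show ?thesis .
  qed
  then have "(\<Sum>d<k. (\<Sum>j<k. rdet k (A(j := unit_row c)) * A j d) * y d) = rdet k A * y c"
    using assms by (simp add: if_distrib[of "\<lambda>x. x * _"] cong: if_cong)
  moreover have "(\<Sum>d<k. (\<Sum>j<k. rdet k (A(j := unit_row c)) * A j d) * y d)
      = (\<Sum>j<k. rdet k (A(j := unit_row c)) * (\<Sum>d<k. A j d * y d))"
    by (simp add: sum_distrib_left sum_distrib_right mult.assoc) (rule sum.swap)
  ultimately show ?thesis by simp
qed

text \<open>The entries of the inverse are at most \<open>\<tau>\<close> in absolute value, so each
  coordinate of \<open>y\<close> is at most \<open>\<tau>\<close> times the 1-norm of the image of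
  \<open>y\<close>. Cauchy-Schwarz contributes one factor \<open>k\<close> to the square, and the
  sum over the \<open>k\<close> coordinates another.\<close>

lemma norm_bound_of_cofactors:
  assumes nz: "rdet k A \<noteq> 0" and \<tau>: "0 \<le> \<tau>"
    and cof: "\<And>j c. j < k \<Longrightarrow> c < k \<Longrightarrow> \<bar>rdet k (A(j := unit_row c))\<bar> \<le> \<tau> * \<bar>rdet k A\<bar>"
  shows "(\<Sum>c<k. (y c)\<^sup>2) \<le> (real k * \<tau>)\<^sup>2 * (\<Sum>i<k. (\<Sum>c<k. A i c * y c)\<^sup>2)"
proof -
  define w where "w i = (\<Sum>c<k. A i c * y c)" for i
  have "(y c)\<^sup>2 \<le> \<tau>\<^sup>2 * (real k * (\<Sum>i<k. (w i)\<^sup>2))" if c: "c < k" for c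
  proof -
    have "\<bar>rdet k A\<bar> * \<bar>y c\<bar> = \<bar>\<Sum>j<k. rdet k (A(j := unit_row c)) * w j\<bar>"
      using cramer_rows[OF c, of A y] by (simp add: w_def flip: abs_mult)
    also have "\<dots> \<le> (\<Sum>j<k. \<bar>rdet k (A(j := unit_row c))\<bar> * \<bar>w j\<bar>)"
      unfolding abs_mult[symmetric] by (rule sum_abs)
    also have "\<dots> \<le> (\<Sum>j<k. \<tau> * \<bar>rdet k A\<bar> * \<bar>w j\<bar>)"
      using cof c by (intro sum_mono mult_right_mono) auto
    also have "\<dots> = \<bar>rdet k A\<bar> * (\<tau> * (\<Sum>j<k. \<bar>w j\<bar>))"
      by (simp add: sum_distrib_left mult_ac)
    finally have "\<bar>y c\<bar> \<le> \<tau> * (\<Sum>j<k. \<bar>w j\<bar>)"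
      using nz by (simp add: mult_le_cancel_left)
    then have "\<bar>y c\<bar>\<^sup>2 \<le> (\<tau> * (\<Sum>j<k. \<bar>w j\<bar>))\<^sup>2" by (intro power_mono) auto
    also have "\<dots> = \<tau>\<^sup>2 * (\<Sum>j<k. 1 * \<bar>w j\<bar>)\<^sup>2" by (simp add: power_mult_distrib)
    also have "\<dots> \<le> \<tau>\<^sup>2 * ((\<Sum>j<k. 1\<^sup>2) * (\<Sum>j<k. \<bar>w j\<bar>\<^sup>2))"
      by (intro mult_left_mono Cauchy_Schwarz_ineq_sum) auto
    finally show ?thesis by simp
  qed
  then have "(\<Sum>c<k. (y c)\<^sup>2) \<le> (\<Sum>c<k. \<tau>\<^sup>2 * (real k * (\<Sum>i<k. (w i)\<^sup>2)))"
    by (intro sum_mono) auto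
  also have "\<dots> = (real k * \<tau>)\<^sup>2 * (\<Sum>i<k. (w i)\<^sup>2)" by (simp add: power2_eq_square mult_ac)
  finally show ?thesis by (simp add: w_def)
qed

section \<open>Coefficients of polynomials with prescribed roots\<close>

lemma abs_coeff_prod_linear_le:
  fixes l :: "'i \<Rightarrow> real"
  assumes "finite T" "\<And>i. i \<in> T \<Longrightarrow> \<bar>l i\<bar> \<le> 1"
  shows "\<bar>Polynomial.coeff (\<Prod>i\<in>T. [:- l i, 1:]) s\<bar> \<le> 2 ^ card T"
  using assms
proof (induction T arbitrary: s rule: finite_induct)
  case empty
  then show ?case by (simp add: coeff_1)
next
  case (insert i T)
  let ?q = "\<Prod>i\<in>T. [:- l i, 1:]"
  have IH: "\<bar>Polynomial.coeff ?q s\<bar> \<le> 2 ^ card T" for s using insert by simp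
  have a: "\<bar>l i * Polynomial.coeff ?q s\<bar> \<le> 1 * 2 ^ card T"
    unfolding abs_mult using insert.prems IH by (intro mult_mono) auto
  have b: "\<bar>case s of 0 \<Rightarrow> 0 | Suc m \<Rightarrow> Polynomial.coeff ?q m\<bar> \<le> 2 ^ card T"
    using IH by (auto split: nat.split)
  have "Polynomial.coeff (\<Prod>i\<in>insert i T. [:- l i, 1:]) s
      = - l i * Polynomial.coeff ?q s + (case s of 0 \<Rightarrow> 0 | Suc m \<Rightarrow> Polynomial.coeff ?q m)"
    using insert.hyps by (simp add: mult_pCons_left coeff_pCons split: nat.split)
  then show ?case using a b insert.hyps by simp
qed

text \<open>The polynomial with coefficients \<open>N\<close> has degree at most
  \<open>card T\<close> and vanishes at every \<open>l i\<close>, so it is a multiple of the product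
  of the linear factors. Its value at \<open>x\<close> fixes the multiple; the gaps bound the
  product at \<open>x\<close> from below, and its coefficients are at most
  \<open>2 ^ card T\<close>.\<close>

lemma coeff_le_of_roots:
  fixes N :: "nat \<Rightarrow> real" and l :: "'i \<Rightarrow> real"
  assumes T: "finite T" "Suc (card T) = t" and inj: "inj_on l T"
    and roots: "\<And>i. i \<in> T \<Longrightarrow> (\<Sum>s<t. l i ^ s * N s) = 0"
    and l1: "\<And>i. i \<in> T \<Longrightarrow> \<bar>l i\<bar> \<le> 1"
    and \<eta>: "0 < \<eta>" "\<And>i. i \<in> T \<Longrightarrow> \<eta> \<le> \<bar>x - l i\<bar>"
    and s: "s < t"
  shows "\<bar>N s\<bar> \<le> (2 / \<eta>) ^ card T * \<bar>\<Sum>s<t. x ^ s * N s\<bar>"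
proof -
  define p where "p = (\<Sum>s<t. Polynomial.monom (N s) s)"
  define q where "q = (\<Prod>i\<in>T. [:- l i, 1:])"
  have pp: "poly p y = (\<Sum>s<t. y ^ s * N s)" for y
    by (simp add: p_def poly_sum poly_monom mult.commute)
  have pc: "Polynomial.coeff p s = N s"
    using s by (simp add: p_def coeff_sum coeff_monom if_distrib cong: if_cong)
  have q: "poly q y = (\<Prod>i\<in>T. y - l i)" for y by (simp add: q_def poly_prod)
  have qc: "\<bar>Polynomial.coeff q s\<bar> \<le> 2 ^ card T"
    unfolding q_def by (rule abs_coeff_prod_linear_le) (use T l1 in auto)
  have xT: "x \<notin> l ` T" using \<eta> by fastforce
  have "\<eta> ^ card T = (\<Prod>i\<in>T. \<eta>)" by simp
  also have "\<dots> \<le> (\<Prod>i\<in>T. \<bar>x - l i\<bar>)" using \<eta> by (intro prod_mono) auto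
  finally have qx: "\<eta> ^ card T \<le> \<bar>poly q x\<bar>" by (simp add: q abs_prod)
  then have qx0: "poly q x \<noteq> 0" using \<eta>(1) by (smt (verit) zero_less_power abs_zero)
  have "Polynomial.degree p < t"
    unfolding p_def using s by (intro degree_sum_less) (auto intro: le_less_trans[OF degree_monom_le])
  moreover have "Polynomial.degree q \<le> card T"
  proof -
    have "Polynomial.degree q \<le> sum (Polynomial.degree \<circ> (\<lambda>i. [:- l i, 1:])) T" unfolding q_def by (rule degree_prod_sum_le[OF T(1)])
    then show ?thesis by simp
  qed
  moreover have "card (insert x (l ` T)) = t"
    using T xT by (simp add: card_image[OF inj])
  \<comment> \<open>Both sides have degree below \<open>t\<close> and agree at \<open>t\<close>
    points: the roots and \<open>x\<close>.\<close>
  ultimately have "p = Polynomial.smult (poly p x / poly q x) q"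
    using roots qx0 T
    by (intro poly_eqI_degree[of "insert x (l ` T)"])
       (auto simp: pp q intro: le_less_trans[OF degree_smult_le])
  then have "N s = poly p x / poly q x * Polynomial.coeff q s"
    using pc by (metis coeff_smult)
  then have "\<bar>N s\<bar> = \<bar>poly p x\<bar> * (\<bar>Polynomial.coeff q s\<bar> / \<bar>poly q x\<bar>)" by (simp add: abs_mult)
  also have "\<dots> \<le> \<bar>poly p x\<bar> * (2 ^ card T / \<eta> ^ card T)"
    using qx \<eta>(1) qc by (intro mult_left_mono frac_le) auto
  finally show ?thesis by (simp add: pp power_divide mult.commute)
qed

section \<open>Krylov determinants\<close>

text \<open>This is row \<open>i\<close> of the Krylov matrix in the eigenbasis; column
  \<open>c\<close> has position \<open>c mod b\<close> in block \<open>c div b\<close>.\<close>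

definition krylov_row :: "(nat \<Rightarrow> real) \<Rightarrow> nat \<Rightarrow> (nat \<Rightarrow> nat \<Rightarrow> real) \<Rightarrow> nat \<Rightarrow> nat \<Rightarrow> real" where
  "krylov_row l b z i c = l i ^ (c div b) * z i (c mod b)"

text \<open>The partial derivative of \<open>krylov_row l b z i\<close> in the variable
  \<open>z i r\<close>.\<close>

definition power_row :: "(nat \<Rightarrow> real) \<Rightarrow> nat \<Rightarrow> nat \<Rightarrow> nat \<Rightarrow> nat \<Rightarrow> real" where
  "power_row l b r i c = (if c mod b = r then l i ^ (c div b) else 0)"

text \<open>By linearity in each row this is the mixed partial derivative of the Krylov determinant
  in the variables \<open>z i (r i)\<close> for \<open>i\<close> in \<open>S\<close>, one variable
  per row.\<close>

definition krylov_det ::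
  "nat \<Rightarrow> (nat \<Rightarrow> real) \<Rightarrow> nat \<Rightarrow> (nat \<Rightarrow> nat) \<Rightarrow> nat set \<Rightarrow> (nat \<Rightarrow> nat \<Rightarrow> real) \<Rightarrow> real" where
  "krylov_det k l b r S z =
     rdet k (\<lambda>i. if i \<in> S then power_row l b (r i) i else krylov_row l b z i)"

text \<open>The differentiated rows, those in \<open>S\<close>, no longer contain
  \<open>z\<close>.\<close>

lemma krylov_det_cong:
  assumes "0 < b" "\<And>i s. i < k \<Longrightarrow> i \<notin> S \<Longrightarrow> s < b \<Longrightarrow> z i s = z' i s"
  shows "krylov_det k l b r S z = krylov_det k l b r S z'"
  unfolding krylov_det_def using assms by (intro rdet_cong) (auto simp: krylov_row_def)

text \<open>Only row \<open>i\<close> changes, by \<open>x\<close> times its derivative. This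
  supplies the affine steps for \<open>gauss_fractional_moment\<close>.\<close>

lemma krylov_det_affine:
  assumes "0 < b" "i < k" "i \<notin> S"
    and z': "\<And>j s. j < k \<Longrightarrow> s < b \<Longrightarrow> z' j s = z j s + (if j = i \<and> s = r i then x else 0)"
  shows "krylov_det k l b r S z' = krylov_det k l b r S z + x * krylov_det k l b r (insert i S) z"
proof -
  let ?M = "\<lambda>i. if i \<in> S then power_row l b (r i) i else krylov_row l b z i"
  have "krylov_det k l b r S z' = rdet k (?M(i := \<lambda>c. x * power_row l b (r i) i c + krylov_row l b z i c))"
    unfolding krylov_det_def using assms
    by (intro rdet_cong) (auto simp: krylov_row_def power_row_def algebra_simps)
  also have "\<dots> = x * rdet k (?M(i := power_row l b (r i) i)) + rdet k (?M(i := krylov_row l b z i))"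
    by (rule rdet_row_linear) fact
  also have "?M(i := power_row l b (r i) i)
      = (\<lambda>j. if j \<in> insert i S then power_row l b (r j) j else krylov_row l b z j)"
    by (auto simp: fun_eq_iff)
  also have "?M(i := krylov_row l b z i) = ?M" using assms by (auto simp: fun_eq_iff)
  finally show ?thesis by (simp add: krylov_det_def)
qed

lemma residue_class_eq_image:
  fixes r b t :: nat
  assumes "r < b"
  shows "{c. c < t * b \<and> c mod b = r} = (\<lambda>s. s * b + r) ` {..<t}"
proof (intro equalityI subsetI)
  fix c assume "c \<in> {c. c < t * b \<and> c mod b = r}"
  then have "c = (c div b) * b + r" "c div b < t"
    using div_mult_mod_eq[of c b] less_mult_imp_div_less[of c t b] by auto
  then show "c \<in> (\<lambda>s. s * b + r) ` {..<t}" by blast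
next
  fix c assume "c \<in> (\<lambda>s. s * b + r) ` {..<t}"
  then obtain s where s: "s < t" "c = s * b + r" by auto
  then have "c < Suc s * b" "Suc s * b \<le> t * b" using assms mult_le_mono1[of "Suc s" t b] by auto
  then have "c < t * b" by linarith
  then show "c \<in> {c. c < t * b \<and> c mod b = r}" using s assms by simp
qed

lemma inj_on_residue_class: "0 < b \<Longrightarrow> inj_on (\<lambda>s. s * b + r) S" for b :: nat
  by (auto simp: inj_on_def)

lemma card_residue_class:
  fixes r b t :: nat
  assumes "r < b"
  shows "card {c. c < t * b \<and> c mod b = r} = t"
  unfolding residue_class_eq_image[OF assms] using assms by (simp add: card_image inj_on_residue_class)

text \<open>In the expansion of the cofactor only the monomials of degree \<open>t - 1\<close> in the column \<open>r\<close>
  survive, since the other terms have a zero block that is too large. The coefficient of a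
  surviving monomial is, up to a Lagrange interpolation factor, a coefficient of the
  determinant itself.\<close>

lemma krylov_cofactor_bound:
  assumes k: "k = t * b" and j: "j < k" and c0: "c0 < k"
    and l1: "\<And>i. i < k \<Longrightarrow> \<bar>l i\<bar> \<le> 1"
    and \<eta>: "0 < \<eta>" and gap: "\<And>i j. i < k \<Longrightarrow> j < k \<Longrightarrow> i \<noteq> j \<Longrightarrow> \<eta> \<le> \<bar>l i - l j\<bar>"
  defines "r \<equiv> c0 mod b"
  shows "\<bar>rdet k ((krylov_row l b z)(j := unit_row c0))\<bar> \<le> (2 / \<eta>) ^ (t - 1) *
    (\<Sum>T | T \<subseteq> {..<k} - {j} \<and> card T = t - 1.
      (\<Prod>i\<in>T. \<bar>z i r\<bar>) * \<bar>krylov_det k l b (\<lambda>_. r) (insert j T) z\<bar>)"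
proof -
  have b: "0 < b" and t: "0 < t" using c0 k by (auto intro!: Nat.gr0I)
  have rb: "r < b" using b by (simp add: r_def)
  define R where "R = {c. c < k \<and> c mod b = r}"
  define A where "A = power_row l b r"
  define B where "B i c = (if c mod b = r then 0 else krylov_row l b z i c)" for i c
  define J where "J = {..<k} - {j}"
  define N where "N T = rdet k (\<lambda>i. if i \<in> T then A i else if i \<in> J then B i else unit_row c0)" for T
  have cR: "card R = t" unfolding R_def k by (rule card_residue_class[OF rb])
  have RJ: "R \<subseteq> {..<k}" "finite J" "J \<subseteq> {..<k}" "card J = k - 1" "j \<notin> J"
    using j by (auto simp: R_def J_def)
  have c0R: "c0 \<in> R" using c0 by (simp add: R_def r_def)
  have A0: "A i c = 0" if "c < k" "c \<notin> R" for i c using that by (auto simp: A_def R_def power_row_def)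
  \<comment> \<open>Each row splits into its entries at position \<open>r\<close>, which are linear
    in \<open>z i r\<close>, and the remaining entries.\<close>
  have row: "krylov_row l b z i = (\<lambda>c. z i r * A i c + B i c)" for i
    by (auto simp: fun_eq_iff krylov_row_def A_def B_def power_row_def)
  have "rdet k ((krylov_row l b z)(j := unit_row c0))
      = rdet k (\<lambda>i. if i \<in> J then (\<lambda>c. z i r * A i c + B i c) else unit_row c0)"
    by (intro rdet_cong) (auto simp: J_def row)
  also have "\<dots> = (\<Sum>T\<in>Pow J. (\<Prod>i\<in>T. z i r) * N T)"
    unfolding N_def by (rule rdet_expand) (use RJ in auto)
  also have "\<dots> = (\<Sum>T | T \<subseteq> J \<and> card T = t - 1. (\<Prod>i\<in>T. z i r) * N T)"
  proof (rule sum.mono_neutral_right)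
    show "\<forall>T\<in>Pow J - {T. T \<subseteq> J \<and> card T = t - 1}. (\<Prod>i\<in>T. z i r) * N T = 0"
    proof
      fix T assume T: "T \<in> Pow J - {T. T \<subseteq> J \<and> card T = t - 1}"
      then have TJ: "T \<subseteq> J" "finite T" using RJ finite_subset by auto
      have "N T = 0"
      proof (cases "card T \<ge> t")
        \<comment> \<open>The rows in \<open>insert j T\<close> number at least \<open>t + 1\<close>
          and are supported on the \<open>t\<close> columns in \<open>R\<close>.\<close>
        case True
        show ?thesis unfolding N_def
        proof (rule rdet_zero_block[of "insert j T" k R])
          show "card R < card (insert j T)" using True cR TJ RJ by (auto simp: card_insert_if)
        qed (use TJ RJ j c0R in \<open>auto simp: A0 unit_row_def\<close>)
      next
        \<comment> \<open>The rows in \<open>J - T\<close> number at least \<open>k - t + 1\<close>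
          and are supported on the \<open>k - t\<close> columns outside \<open>R\<close>.\<close>
        case False
        then have ct: "card T < t - 1" using T TJ by auto
        show ?thesis unfolding N_def
        proof (rule rdet_zero_block[of "J - T" k "{..<k} - R"])
          have "card ({..<k} - R) = k - t" using RJ cR by (simp add: card_Diff_subset finite_subset[OF RJ(1)])
          moreover have "card (J - T) = k - 1 - card T" using RJ TJ by (simp add: card_Diff_subset)
          moreover have "t \<le> k" using b k by simp
          ultimately show "card ({..<k} - R) < card (J - T)" using ct by linarith
        qed (use TJ RJ in \<open>auto simp: B_def R_def\<close>)
      qed
      then show "(\<Prod>i\<in>T. z i r) * N T = 0" by simp
    qed
  qed (use RJ in auto)
  finally have "\<bar>rdet k ((krylov_row l b z)(j := unit_row c0))\<bar>
      \<le> (\<Sum>T | T \<subseteq> J \<and> card T = t - 1. (\<Prod>i\<in>T. \<bar>z i r\<bar>) * \<bar>N T\<bar>)"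
    using sum_abs[of "\<lambda>T. (\<Prod>i\<in>T. z i r) * N T" "{T. T \<subseteq> J \<and> card T = t - 1}"]
    by (simp add: abs_mult abs_prod)
  also have "\<dots> \<le> (\<Sum>T | T \<subseteq> J \<and> card T = t - 1. (\<Prod>i\<in>T. \<bar>z i r\<bar>) *
      ((2 / \<eta>) ^ (t - 1) * \<bar>krylov_det k l b (\<lambda>_. r) (insert j T) z\<bar>))"
  proof (intro sum_mono mult_left_mono)
    fix T assume "T \<in> {T. T \<subseteq> J \<and> card T = t - 1}"
    then have T: "T \<subseteq> J" "finite T" "card T = t - 1" using RJ finite_subset by auto
    let ?M = "\<lambda>i. if i \<in> T then A i else B i"
    \<comment> \<open>Letting the unit vector in row \<open>j\<close> run over all columns of
      position \<open>r\<close> gives the coefficients of a polynomial. Its value at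
      \<open>l i\<close> is the determinant with \<open>A i\<close> in row \<open>j\<close>: it is 0
      for \<open>i\<close> in \<open>T\<close> because two rows coincide, and at \<open>l j\<close>
      it is the derivative in the claim.\<close>
    define n where "n s = rdet k (?M(j := unit_row (s * b + r)))" for s
    have D: "(\<Sum>s<t. l i ^ s * n s) = rdet k (?M(j := A i))" for i
    proof -
      have "(\<Sum>s<t. l i ^ s * n s) = rdet k (?M(j := \<lambda>c. \<Sum>s<t. l i ^ s * unit_row (s * b + r) c))"
        unfolding n_def by (rule rdet_row_sum[OF j, symmetric])
      also have "\<dots> = rdet k (?M(j := A i))"
      proof (rule rdet_cong)
        fix i' c assume c: "c < k"
        have "(\<Sum>s<t. l i ^ s * unit_row (s * b + r) c) = (\<Sum>s<t. if s = c div b \<and> c mod b = r then l i ^ s else 0)"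
        proof (rule sum.cong[OF refl])
          fix s
          have "c = s * b + r \<longleftrightarrow> s = c div b \<and> c mod b = r" using rb b by auto
          then show "l i ^ s * unit_row (s * b + r) c = (if s = c div b \<and> c mod b = r then l i ^ s else 0)"
            by (auto simp: unit_row_def)
        qed
        also have "\<dots> = A i c"
          using c k by (cases "c mod b = r") (auto simp: A_def power_row_def less_mult_imp_div_less)
        finally show "(?M(j := \<lambda>c. \<Sum>s<t. l i ^ s * unit_row (s * b + r) c)) i' c = (?M(j := A i)) i' c"
          by simp
      qed
      finally show ?thesis .
    qed
    have "\<bar>n (c0 div b)\<bar> \<le> (2 / \<eta>) ^ card T * \<bar>\<Sum>s<t. l j ^ s * n s\<bar>"
    proof (rule coeff_le_of_roots[OF T(2)])
      show "inj_on l T"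
      proof (rule inj_onI, rule ccontr)
        fix i i' assume "i \<in> T" "i' \<in> T" "l i = l i'" "i \<noteq> i'"
        moreover from this have "i < k" "i' < k" using T(1) RJ(3) by auto
        ultimately show False using gap[of i i'] \<eta> by simp
      qed
      show "(\<Sum>s<t. l i ^ s * n s) = 0" if "i \<in> T" for i
        unfolding D using that T(1) RJ j by (intro rdet_identical_rows[of i k j]) auto
      show "\<bar>l i\<bar> \<le> 1" if "i \<in> T" for i using l1 that T(1) RJ by auto
      show "\<eta> \<le> \<bar>l j - l i\<bar>" if "i \<in> T" for i using that T(1) RJ j by (intro gap) auto
      show "c0 div b < t" using c0 k by (simp add: less_mult_imp_div_less)
    qed (use T t \<eta> in auto)
    moreover have "n (c0 div b) = N T"
    proof -
      have "c0 div b * b + r = c0" by (simp add: r_def)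
      moreover have "j \<notin> T" using T(1) RJ(5) by blast
      moreover have "i \<in> J \<longleftrightarrow> i \<noteq> j" if "i < k" for i using that by (simp add: J_def)
      ultimately show ?thesis unfolding n_def N_def by (intro rdet_cong) simp
    qed
    moreover have "rdet k (?M(j := A j)) = krylov_det k l b (\<lambda>_. r) (insert j T) z"
      unfolding krylov_det_def
    \<comment> \<open>The rows in \<open>insert j T\<close> use up all columns of \<open>R\<close>,
      so the other rows may get back their \<open>krylov_row\<close> entries there.\<close>
    proof (rule rdet_block_cong[of "insert j T" k R])
      show "card (insert j T) = card R" using T RJ t cR by (auto simp: card_insert_if)
    qed (use T RJ j in \<open>auto simp: A0 A_def[symmetric] B_def R_def\<close>)
    ultimately show "\<bar>N T\<bar> \<le> (2 / \<eta>) ^ (t - 1) * \<bar>krylov_det k l b (\<lambda>_. r) (insert j T) z\<bar>"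
      using T(3) D by simp
  qed (auto intro: prod_nonneg)
  finally show ?thesis by (simp add: sum_distrib_left mult_ac J_def)
qed

text \<open>After reordering, the matrix is block diagonal with one Vandermonde block per residue
  class modulo \<open>b\<close>. A kernel vector yields polynomials of degree below \<open>t\<close>
  with \<open>t\<close> distinct roots, hence is 0.\<close>

lemma power_row_det_nonzero:
  assumes k: "k = t * b" and b: "0 < b" and inj: "inj_on l {..<k}"
  shows "krylov_det k l b (\<lambda>i. i mod b) {..<k} z \<noteq> 0"
proof
  assume "krylov_det k l b (\<lambda>i. i mod b) {..<k} z = 0"
  then have "rdet k (\<lambda>i. power_row l b (i mod b) i) = 0"
    unfolding krylov_det_def by (subst (asm) rdet_cong[where B="\<lambda>i. power_row l b (i mod b) i"]) auto
  then obtain v where v: "v \<in> carrier_vec k" "v \<noteq> 0\<^sub>v k"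
    and v0: "mat k k (\<lambda>(i, c). power_row l b (i mod b) i c) *\<^sub>v v = 0\<^sub>v k"
    unfolding rdet_def by (subst (asm) det_0_iff_vec_prod_zero[of _ k]) auto
  have "v $ c = 0" if c: "c < k" for c
  proof -
    define r where "r = c mod b"
    have r: "r < b" using b by (simp add: r_def)
    define p where "p = (\<Sum>s<t. Polynomial.monom (v $ (s * b + r)) s)"
    have "poly p (l i) = 0" if i: "i < k" "i mod b = r" for i
    proof -
      have "0 = (\<Sum>c<k. power_row l b r i c * v $ c)"
        using arg_cong[OF v0, of "\<lambda>u. u $ i"] i v(1) by (simp add: scalar_prod_def lessThan_atLeast0)
      also have "\<dots> = (\<Sum>c | c < k \<and> c mod b = r. l i ^ (c div b) * v $ c)"
        by (rule sum.mono_neutral_cong_right) (auto simp: power_row_def)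
      also have "\<dots> = (\<Sum>s<t. l i ^ s * v $ (s * b + r))"
        unfolding k residue_class_eq_image[OF r] using b r
        by (subst sum.reindex) (auto simp: inj_on_residue_class)
      also have "\<dots> = poly p (l i)" by (simp add: p_def poly_sum poly_monom mult.commute)
      finally show ?thesis by simp
    qed
    then have roots: "poly p x = poly 0 x" if "x \<in> l ` {c. c < t * b \<and> c mod b = r}" for x
      using that k by auto
    have t: "0 < t" using c k by (auto intro!: Nat.gr0I)
    have card: "card (l ` {c. c < t * b \<and> c mod b = r}) = t"
      using card_residue_class[OF r, of t] inj k
      by (subst card_image) (auto intro: inj_on_subset)
    have "Polynomial.degree p < t"
      unfolding p_def using t by (intro degree_sum_less) (auto intro: le_less_trans[OF degree_monom_le])
    then have "p = 0" using roots card t by (intro poly_eqI_degree[of "l ` {c. c < t * b \<and> c mod b = r}"]) auto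
    have "c div b < t" using c k by (simp add: less_mult_imp_div_less)
    then have "v $ c = Polynomial.coeff p (c div b)"
      by (simp add: p_def coeff_sum coeff_monom if_distrib r_def cong: if_cong)
    then show ?thesis using \<open>p = 0\<close> by simp
  qed
  then have "v = 0\<^sub>v k" using v(1) by (intro eq_vecI) auto
  then show False using v(2) by simp
qed

section \<open>The smallest singular value and orthonormal eigenvectors\<close>

definition sqnorm :: "nat \<Rightarrow> (nat \<Rightarrow> real) \<Rightarrow> real" where
  "sqnorm k x = (\<Sum>i<k. (x i)\<^sup>2)"

definition mulv :: "nat \<Rightarrow> (nat \<Rightarrow> nat \<Rightarrow> real) \<Rightarrow> (nat \<Rightarrow> real) \<Rightarrow> nat \<Rightarrow> real" where
  "mulv k A x i = (\<Sum>c<k. A i c * x c)"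

lemma sqnorm_nonneg: "0 \<le> sqnorm k x"
  by (simp add: sqnorm_def sum_nonneg)

lemma sqnorm_mulv_scale: "sqnorm k (mulv k A (\<lambda>i. a * x i)) = a\<^sup>2 * sqnorm k (mulv k A x)"
proof -
  have "mulv k A (\<lambda>i. a * x i) i = a * mulv k A x i" for i
    by (simp add: mulv_def sum_distrib_left mult_ac)
  then show ?thesis by (simp add: sqnorm_def power_mult_distrib sum_distrib_left)
qed

text \<open>The unit sphere is compact, so the quadratic form attains its minimum on it; homogeneity
  extends the inequality to all vectors.\<close>

lemma min_rayleigh_exists:
  assumes k: "0 < k"
  shows "\<exists>v. sqnorm k v = 1 \<and> (\<forall>x. sqnorm k (mulv k A v) * sqnorm k x \<le> sqnorm k (mulv k A x))"
proof -
  \<comment> \<open>Coordinates from \<open>k\<close> on are pinned to 0, which makes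
    \<open>B\<close> a product of compact sets.\<close>
  define B where "B = (\<Pi>\<^sub>E i\<in>UNIV. if i < k then {-1..1} else {0::real})"
  define S where "S = B \<inter> {x. sqnorm k x = 1}"
  have coord: "continuous_on X (\<lambda>x::nat \<Rightarrow> real. x i)" for X i
    by (rule continuous_on_subset[OF continuous_on_product_coordinates]) simp
  have "compactin (product_topology (\<lambda>_. euclideanreal) UNIV) B"
    unfolding B_def compactin_PiE by auto
  then have "compact B" by (simp add: euclidean_product_topology)
  moreover have "closed {x. sqnorm k x = 1}"
    unfolding sqnorm_def by (intro closed_Collect_eq continuous_on_sum continuous_on_power coord continuous_on_const)
  ultimately have "compact S" unfolding S_def by (rule compact_Int_closed)
  moreover have "(\<lambda>i. if i = 0 then 1 else 0) \<in> S"
  proof -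
    have "sqnorm k (\<lambda>i. if i = 0 then 1 else 0) = (\<Sum>i<k. if i = 0 then 1 else 0)"
      unfolding sqnorm_def by (intro sum.cong) auto
    then show ?thesis using k by (auto simp: S_def B_def)
  qed
  then have "S \<noteq> {}" by auto
  moreover have "continuous_on S (\<lambda>x. sqnorm k (mulv k A x))"
    unfolding sqnorm_def mulv_def
    by (intro continuous_on_sum continuous_on_power continuous_on_mult continuous_on_const coord)
  ultimately have "\<exists>v\<in>S. \<forall>x\<in>S. sqnorm k (mulv k A v) \<le> sqnorm k (mulv k A x)"
    by (rule continuous_attains_inf)
  then obtain v where v: "v \<in> S" and min: "\<And>x. x \<in> S \<Longrightarrow> sqnorm k (mulv k A v) \<le> sqnorm k (mulv k A x)"
    by blast
  have "sqnorm k (mulv k A v) * sqnorm k x \<le> sqnorm k (mulv k A x)" for x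
  proof (cases "sqnorm k x = 0")
    case True
    then show ?thesis by (simp add: sqnorm_nonneg)
  next
    case False
    then have N: "0 < sqnorm k x" using sqnorm_nonneg[of k x] by linarith
    define a where "a = 1 / sqrt (sqnorm k x)"
    have a2: "a\<^sup>2 * sqnorm k x = 1" using N by (simp add: a_def power_divide)
    define y where "y i = (if i < k then a * x i else 0)" for i
    have ny: "sqnorm k y = 1"
    proof -
      have "sqnorm k y = a\<^sup>2 * sqnorm k x"
        by (simp add: sqnorm_def y_def power_mult_distrib sum_distrib_left)
      then show ?thesis using a2 by simp
    qed
    have "\<bar>y i\<bar> \<le> 1" if "i < k" for i
    proof -
      have "(y i)\<^sup>2 \<le> sqnorm k y" unfolding sqnorm_def by (rule member_le_sum) (use that in auto)
      then show ?thesis using ny by (simp add: abs_square_le_1)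
    qed
    moreover have "y i = 0" if "\<not> i < k" for i using that by (simp add: y_def)
    ultimately have "y \<in> B" by (auto simp: B_def abs_le_iff minus_le_iff)
    then have "sqnorm k (mulv k A v) \<le> sqnorm k (mulv k A y)" using ny by (intro min) (simp add: S_def)
    also have "mulv k A y = mulv k A (\<lambda>i. a * x i)" by (simp add: mulv_def y_def fun_eq_iff)
    also have "sqnorm k \<dots> = a\<^sup>2 * sqnorm k (mulv k A x)" by (rule sqnorm_mulv_scale)
    finally have "sqnorm k (mulv k A v) * sqnorm k x \<le> a\<^sup>2 * sqnorm k (mulv k A x) * sqnorm k x"
      using N by (intro mult_right_mono) auto
    also have "\<dots> = sqnorm k (mulv k A x) * (a\<^sup>2 * sqnorm k x)" by simp
    finally show ?thesis using a2 by simp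
  qed
  then show ?thesis using v by (auto simp: S_def)
qed

lemma linear_term_zero:
  fixes B C :: real
  assumes "\<And>e. 0 \<le> 2 * e * B + e\<^sup>2 * C"
  shows "B = 0"
proof (rule ccontr)
  assume "B \<noteq> 0"
  \<comment> \<open>Since \<open>D\<close> is positive and exceeds \<open>C\<close>, the choice
    \<open>e = - B / D\<close> makes the expression negative.\<close>
  define D where "D = \<bar>C\<bar> + 1"
  have D: "0 < D" "C < D" by (auto simp: D_def)
  have "0 \<le> 2 * (- B / D) * B + (- B / D)\<^sup>2 * C" by (rule assms)
  also have "\<dots> = B\<^sup>2 / D * (C / D - 2)" using D by (simp add: power2_eq_square field_simps)
  also have "\<dots> < 0"
    using D \<open>B \<noteq> 0\<close> by (intro mult_pos_neg) (auto simp: field_simps)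
  finally show False by simp
qed

text \<open>The first variation at the minimiser \<open>v\<close> vanishes in the direction of the
  unit vector \<open>d\<close>. Over all \<open>d\<close> this is the equation of an eigenvector of
  the Gram matrix for \<open>\<mu>\<close>.\<close>

lemma min_rayleigh_critical:
  assumes v: "\<And>x. \<mu> * sqnorm k x \<le> sqnorm k (mulv k A x)"
    and eq: "\<mu> * sqnorm k v = sqnorm k (mulv k A v)"
    and d: "d < k"
  shows "(\<Sum>i<k. A i d * mulv k A v i) = \<mu> * v d"
proof -
  have "(\<Sum>i<k. A i d * mulv k A v i) - \<mu> * v d = 0"
  proof (rule linear_term_zero)
    fix e
    define x where "x i = v i + e * (if i = d then 1 else 0)" for i
    have mx: "mulv k A x i = mulv k A v i + e * A i d" for i
    proof -
      have "mulv k A x i = mulv k A v i + e * (\<Sum>c<k. if c = d then A i c else 0)"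
        unfolding mulv_def x_def sum_distrib_left sum.distrib[symmetric]
        by (intro sum.cong) (auto simp: algebra_simps)
      then show ?thesis using d by simp
    qed
    have 1: "sqnorm k (mulv k A x) = sqnorm k (mulv k A v)
        + 2 * e * (\<Sum>i<k. A i d * mulv k A v i) + e\<^sup>2 * (\<Sum>i<k. (A i d)\<^sup>2)"
      unfolding sqnorm_def mx sum_distrib_left sum.distrib[symmetric]
      by (intro sum.cong) (auto simp: power2_eq_square algebra_simps)
    have "sqnorm k x = (\<Sum>i<k. (v i)\<^sup>2 + (if i = d then 2 * e * v i + e\<^sup>2 else 0))"
      unfolding sqnorm_def by (intro sum.cong) (auto simp: x_def power2_eq_square algebra_simps)
    then have 2: "sqnorm k x = sqnorm k v + (2 * e * v d + e\<^sup>2)"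
      using d by (simp add: sum.distrib sqnorm_def)
    have "\<mu> * (sqnorm k v + (2 * e * v d + e\<^sup>2)) \<le> sqnorm k (mulv k A x)" using v[of x] unfolding 2 .
    then have "0 \<le> 2 * e * (\<Sum>i<k. A i d * mulv k A v i) + e\<^sup>2 * (\<Sum>i<k. (A i d)\<^sup>2) - \<mu> * (2 * e * v d + e\<^sup>2)"
      unfolding 1 distrib_left eq by linarith
    then show "0 \<le> 2 * e * ((\<Sum>i<k. A i d * mulv k A v i) - \<mu> * v d) + e\<^sup>2 * ((\<Sum>i<k. (A i d)\<^sup>2) - \<mu>)"
      by (simp add: algebra_simps)
  qed
  then show ?thesis by simp
qed

lemma mult_transpose_vec_index:
  fixes A :: "real mat"
  assumes A: "A \<in> carrier_mat k k" and w: "w \<in> carrier_vec k" and d: "d < k"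
  shows "((A\<^sup>T * A) *\<^sub>v w) $ d = (\<Sum>i<k. A $$ (i, d) * mulv k (\<lambda>i c. A $$ (i, c)) (\<lambda>c. w $ c) i)"
proof -
  have "(A\<^sup>T * A) *\<^sub>v w = A\<^sup>T *\<^sub>v (A *\<^sub>v w)" using A w by (intro assoc_mult_mat_vec) auto
  then show ?thesis using A w d by (simp add: scalar_prod_def mulv_def lessThan_atLeast0)
qed

text \<open>The minimal Rayleigh quotient is itself an eigenvalue of the Gram matrix, which gives
  one direction and shows that \<open>Min\<close> is taken over a nonempty set. Conversely, an
  eigenvector for \<open>\<mu>\<close> has Rayleigh quotient \<open>\<mu>\<close>.\<close>

lemma sigma_min_ge_iff:
  assumes A: "A \<in> carrier_mat k k" and k: "0 < k" and s: "0 \<le> s"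
  shows "sigma_min A \<ge> s \<longleftrightarrow>
    (\<forall>x. s\<^sup>2 * sqnorm k x \<le> sqnorm k (mulv k (\<lambda>i c. A $$ (i, c)) x))"
    (is "_ \<longleftrightarrow> (\<forall>x. _ \<le> ?q x)")
proof -
  let ?A = "\<lambda>i c. A $$ (i, c)"
  have AA: "A\<^sup>T * A \<in> carrier_mat k k" using A by auto
  obtain v where v: "sqnorm k v = 1" "\<And>x. ?q v * sqnorm k x \<le> ?q x"
    using min_rayleigh_exists[OF k, of ?A] by blast
  have "(A\<^sup>T * A) *\<^sub>v vec k v = ?q v \<cdot>\<^sub>v vec k v"
  proof (rule eq_vecI)
    fix d assume "d < dim_vec (?q v \<cdot>\<^sub>v vec k v)"
    then have d: "d < k" by simp
    have "mulv k ?A (\<lambda>c. vec k v $ c) = mulv k ?A v" by (simp add: mulv_def fun_eq_iff)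
    then show "((A\<^sup>T * A) *\<^sub>v vec k v) $ d = (?q v \<cdot>\<^sub>v vec k v) $ d"
      using mult_transpose_vec_index[OF A _ d, of "vec k v"] min_rayleigh_critical[OF v(2) _ d, of v] v(1) d
      by simp
  qed (use A in simp)
  moreover have "vec k v \<noteq> 0\<^sub>v k"
  proof
    assume "vec k v = 0\<^sub>v k"
    then have "v i = 0" if "i < k" for i using that by (metis index_vec index_zero_vec(1))
    then show False using v(1) by (simp add: sqnorm_def)
  qed
  ultimately have "eigenvector (A\<^sup>T * A) (vec k v) (?q v)"
    using AA by (auto simp: eigenvector_def)
  then have spec: "?q v \<in> spectrum (A\<^sup>T * A)" by (auto simp: spectrum_def eigenvalue_def)
  have fin: "finite (singular_values A)"
    unfolding singular_values_def using card_finite_spectrum(1)[OF AA] by simp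
  show ?thesis
  proof
    assume "sigma_min A \<ge> s"
    also have "sigma_min A \<le> sqrt (?q v)"
      unfolding sigma_min_def by (rule Min_le[OF fin]) (use spec in \<open>auto simp: singular_values_def\<close>)
    finally have "s\<^sup>2 \<le> ?q v" using s sqnorm_nonneg real_sqrt_le_iff by (metis power_mono real_sqrt_pow2)
    then show "\<forall>x. s\<^sup>2 * sqnorm k x \<le> ?q x"
      using v(2) by (meson mult_right_mono order_trans sqnorm_nonneg)
  next
    assume *: "\<forall>x. s\<^sup>2 * sqnorm k x \<le> ?q x"
    have "s \<le> sqrt \<mu>" if \<mu>: "\<mu> \<in> spectrum (A\<^sup>T * A)" for \<mu>
    proof -
      obtain w where w: "w \<in> carrier_vec k" "w \<noteq> 0\<^sub>v k" "(A\<^sup>T * A) *\<^sub>v w = \<mu> \<cdot>\<^sub>v w"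
        using \<mu> A by (auto simp: spectrum_def eigenvalue_def eigenvector_def)
      let ?w = "\<lambda>c. w $ c"
      have "\<mu> * sqnorm k ?w = (\<Sum>d<k. w $ d * ((A\<^sup>T * A) *\<^sub>v w) $ d)"
        unfolding w(3) using w(1) by (simp add: sqnorm_def sum_distrib_left power2_eq_square mult_ac)
      also have "\<dots> = (\<Sum>d<k. w $ d * (\<Sum>i<k. A $$ (i, d) * mulv k ?A ?w i))"
        using mult_transpose_vec_index[OF A w(1)] by simp
      also have "\<dots> = (\<Sum>i<k. \<Sum>d<k. A $$ (i, d) * w $ d * mulv k ?A ?w i)"
        unfolding sum_distrib_left by (subst sum.swap) (simp add: mult_ac)
      also have "\<dots> = ?q ?w"
        by (simp add: sqnorm_def power2_eq_square sum_distrib_right[symmetric]) (simp add: mulv_def)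
      finally have "s\<^sup>2 * sqnorm k ?w \<le> \<mu> * sqnorm k ?w" using * by simp
      moreover have "sqnorm k ?w > 0"
      proof -
        obtain i where "i < k" "w $ i \<noteq> 0" using w(1,2) by (metis carrier_vecD eq_vecI index_zero_vec)
        then show ?thesis unfolding sqnorm_def by (intro sum_pos2[of _ i]) auto
      qed
      ultimately have "s\<^sup>2 \<le> \<mu>" by simp
      then show ?thesis by (rule real_le_rsqrt)
    qed
    then show "sigma_min A \<ge> s"
      unfolding sigma_min_def using spec fin by (subst Min_ge_iff) (auto simp: singular_values_def)
  qed
qed

text \<open>Both sides are continuous and rational vectors are dense. Lists of rationals form a
  countable type, so measurability reduces to a countable intersection.\<close>

lemma rational_test_vectors:
  assumes "\<And>xs :: rat list. s * sqnorm k (\<lambda>i. of_rat (xs ! i)) \<le> sqnorm k (mulv k A (\<lambda>i. of_rat (xs ! i)))"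
  shows "s * sqnorm k x \<le> sqnorm k (mulv k A x)"
proof -
  have "\<exists>q::rat. x i < of_rat q \<and> of_rat q < x i + 1 / real (Suc m)" for i m
    by (rule of_rat_dense) simp
  then obtain q :: "nat \<Rightarrow> nat \<Rightarrow> rat" where
    q: "\<And>i m. x i < of_rat (q i m) \<and> of_rat (q i m) < x i + 1 / real (Suc m)" by metis
  have lim: "(\<lambda>m. of_rat (q i m)) \<longlonglongrightarrow> x i" for i
  proof (rule tendsto_sandwich[OF always_eventually always_eventually])
    show "\<forall>m. x i \<le> of_rat (q i m)" "\<forall>m. of_rat (q i m) \<le> x i + 1 / real (Suc m)"
      using q less_imp_le by blast+
    show "(\<lambda>m. x i + 1 / real (Suc m)) \<longlonglongrightarrow> x i"
      using tendsto_add[OF tendsto_const[of "x i"] LIMSEQ_Suc[OF lim_1_over_n]] by simp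
  qed simp
  have "s * sqnorm k (\<lambda>i. of_rat (q i m)) \<le> sqnorm k (mulv k A (\<lambda>i. of_rat (q i m)))" for m
    using assms[of "map (\<lambda>i. q i m) [0..<k]"] by (simp add: sqnorm_def mulv_def)
  moreover have "(\<lambda>m. s * sqnorm k (\<lambda>i. of_rat (q i m))) \<longlonglongrightarrow> s * sqnorm k x"
    unfolding sqnorm_def by (intro tendsto_intros lim)
  moreover have "(\<lambda>m. sqnorm k (mulv k A (\<lambda>i. of_rat (q i m)))) \<longlonglongrightarrow> sqnorm k (mulv k A x)"
    unfolding sqnorm_def mulv_def by (intro tendsto_intros lim)
  ultimately show ?thesis by (meson LIMSEQ_le)
qed

text \<open>Symmetry makes eigenvectors for distinct eigenvalues orthogonal, so one normalised
  eigenvector for each \<open>l i\<close> suffices. The second property says that each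
  \<open>q i\<close> is a left eigenvector of all powers of \<open>C\<close>.\<close>

lemma orthonormal_eigenbasis:
  fixes C :: "real mat"
  assumes C: "C \<in> carrier_mat k k" and sym: "C\<^sup>T = C"
    and eig: "\<And>i. i < k \<Longrightarrow> l i \<in> spectrum C" and inj: "inj_on l {..<k}"
  obtains q :: "nat \<Rightarrow> nat \<Rightarrow> real" where
    "\<And>i j. i < k \<Longrightarrow> j < k \<Longrightarrow> (\<Sum>a<k. q i a * q j a) = (if i = j then 1 else 0)"
    "\<And>i s c. i < k \<Longrightarrow> c < k \<Longrightarrow> (\<Sum>a<k. q i a * (C ^\<^sub>m s) $$ (a, c)) = l i ^ s * q i c"
proof -
  have Csym: "C $$ (c, d) = C $$ (d, c)" if "c < k" "d < k" for c d
    using that C sym by (metis carrier_matD index_transpose_mat(1))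
  have "\<exists>u. (\<Sum>a<k. (u a)\<^sup>2) = 1 \<and> (\<forall>a<k. (\<Sum>c<k. C $$ (a, c) * u c) = l i * u a)" if i: "i < k" for i
  proof -
    obtain w where w: "w \<in> carrier_vec k" "w \<noteq> 0\<^sub>v k" "C *\<^sub>v w = l i \<cdot>\<^sub>v w"
      using eig[OF i] C by (auto simp: spectrum_def eigenvalue_def eigenvector_def)
    define n where "n = (\<Sum>a<k. (w $ a)\<^sup>2)"
    obtain a where "a < k" "w $ a \<noteq> 0" using w(1,2) by (metis carrier_vecD eq_vecI index_zero_vec)
    then have n: "n > 0" unfolding n_def by (intro sum_pos2[of _ a]) auto
    have ev: "(\<Sum>c<k. C $$ (a, c) * w $ c) = l i * w $ a" if "a < k" for a
      using arg_cong[OF w(3), of "\<lambda>u. u $ a"] that C w(1) by (simp add: scalar_prod_def lessThan_atLeast0)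
    show ?thesis
    proof (intro exI[of _ "\<lambda>a. w $ a / sqrt n"] conjI allI impI)
      show "(\<Sum>a<k. (w $ a / sqrt n)\<^sup>2) = 1"
        using n by (simp add: power_divide flip: sum_divide_distrib) (simp add: n_def)
      show "(\<Sum>c<k. C $$ (a, c) * (w $ c / sqrt n)) = l i * (w $ a / sqrt n)" if "a < k" for a
        using ev[OF that] by (simp flip: sum_divide_distrib)
    qed
  qed
  then have "\<forall>i\<in>{..<k}. \<exists>u. (\<Sum>a<k. (u a)\<^sup>2) = 1 \<and> (\<forall>a<k. (\<Sum>c<k. C $$ (a, c) * u c) = l i * u a)"
    by simp
  from bchoice[OF this] obtain q where "\<forall>i\<in>{..<k}. (\<Sum>a<k. (q i a)\<^sup>2) = 1 \<and> (\<forall>a<k. (\<Sum>c<k. C $$ (a, c) * q i c) = l i * q i a)" ..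
  then have q1: "\<And>i. i < k \<Longrightarrow> (\<Sum>a<k. (q i a)\<^sup>2) = 1"
    and q2: "\<And>i a. i < k \<Longrightarrow> a < k \<Longrightarrow> (\<Sum>c<k. C $$ (a, c) * q i c) = l i * q i a" by auto
  have q2': "(\<Sum>a<k. q i a * C $$ (a, c)) = l i * q i c" if "i < k" "c < k" for i c
    using q2[OF that] Csym that by (simp add: mult.commute)
  show thesis
  proof
    fix i j assume ij: "i < k" "j < k"
    show "(\<Sum>a<k. q i a * q j a) = (if i = j then 1 else 0)"
    proof (cases "i = j")
      case False
      have "l i * (\<Sum>a<k. q i a * q j a) = (\<Sum>c<k. (\<Sum>a<k. q i a * C $$ (a, c)) * q j c)"
        using q2' ij by (simp add: sum_distrib_left mult_ac)
      also have "\<dots> = (\<Sum>a<k. q i a * (\<Sum>c<k. C $$ (a, c) * q j c))"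
        by (simp add: sum_distrib_left sum_distrib_right mult_ac) (rule sum.swap)
      also have "\<dots> = l j * (\<Sum>a<k. q i a * q j a)"
        using q2 ij by (simp add: sum_distrib_left mult_ac)
      finally have "(l i - l j) * (\<Sum>a<k. q i a * q j a) = 0" by (simp add: algebra_simps)
      moreover have "l i \<noteq> l j" using inj ij False by (auto simp: inj_on_def)
      ultimately show ?thesis using False by simp
    qed (use q1 ij in \<open>simp add: power2_eq_square\<close>)
  next
    fix i s c assume i: "i < k" and c: "c < k"
    show "(\<Sum>a<k. q i a * (C ^\<^sub>m s) $$ (a, c)) = l i ^ s * q i c" using c
    proof (induction s arbitrary: c)
      case 0
      have "(\<Sum>a<k. q i a * (1\<^sub>m k) $$ (a, c)) = (\<Sum>a<k. if a = c then q i a else 0)"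
        using 0 by (intro sum.cong) auto
      then show ?case using 0 C by simp
    next
      case (Suc s)
      have Cs: "C ^\<^sub>m s \<in> carrier_mat k k" using C by (rule pow_carrier_mat)
      have "(\<Sum>a<k. q i a * (C ^\<^sub>m Suc s) $$ (a, c)) = (\<Sum>a<k. q i a * (\<Sum>d<k. (C ^\<^sub>m s) $$ (a, d) * C $$ (d, c)))"
        using Cs C Suc.prems by (intro sum.cong) (auto simp: scalar_prod_def lessThan_atLeast0)
      also have "\<dots> = (\<Sum>d<k. (\<Sum>a<k. q i a * (C ^\<^sub>m s) $$ (a, d)) * C $$ (d, c))"
        by (simp add: sum_distrib_left sum_distrib_right mult_ac) (rule sum.swap)
      also have "\<dots> = l i ^ s * (\<Sum>d<k. q i d * C $$ (d, c))"
        using Suc.IH by (simp add: sum_distrib_left mult_ac)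
      finally show ?case using q2'[OF i Suc.prems] by simp
    qed
  qed
qed

text \<open>For a square matrix orthonormal rows imply orthonormal columns, and the cross terms of
  the expanded square cancel.\<close>

lemma sqnorm_orthonormal:
  assumes orth: "\<And>i j. i < k \<Longrightarrow> j < k \<Longrightarrow> (\<Sum>a<k. q i a * q j a) = (if i = j then 1 else 0)"
  shows "sqnorm k (mulv k q x) = sqnorm k x"
proof -
  let ?Q = "mat k k (\<lambda>(i, a). q i a)"
  have "?Q * ?Q\<^sup>T = 1\<^sub>m k"
    using orth by (intro eq_matI) (auto simp: scalar_prod_def lessThan_atLeast0)
  then have QQ: "?Q\<^sup>T * ?Q = 1\<^sub>m k" by (rule mat_mult_left_right_inverse[rotated 2]) simp_all
  have col: "(\<Sum>i<k. q i a * q i c) = (if a = c then 1 else 0)" if "a < k" "c < k" for a c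
    using arg_cong[of _ _ "\<lambda>M. M $$ (a, c)", OF QQ] that
    by (simp add: scalar_prod_def lessThan_atLeast0)
  have "sqnorm k (mulv k q x) = (\<Sum>i<k. \<Sum>a<k. \<Sum>c<k. q i a * x a * (q i c * x c))"
    by (simp add: sqnorm_def mulv_def power2_eq_square sum_product)
  also have "\<dots> = (\<Sum>a<k. \<Sum>c<k. \<Sum>i<k. q i a * x a * (q i c * x c))"
    by (subst sum.swap, intro sum.cong refl sum.swap)
  also have "\<dots> = (\<Sum>a<k. \<Sum>c<k. x a * x c * (\<Sum>i<k. q i a * q i c))"
    by (simp add: sum_distrib_left mult_ac)
  also have "\<dots> = (\<Sum>a<k. \<Sum>c<k. if c = a then (x a)\<^sup>2 else 0)"
    using col by (intro sum.cong) (auto simp: power2_eq_square)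
  finally show ?thesis by (simp add: sqnorm_def)
qed

section \<open>Tail bounds for the cofactors\<close>

lemma sqrt_sum_le_sum_sqrt:
  assumes "finite S" "\<And>i. i \<in> S \<Longrightarrow> 0 \<le> f i"
  shows "sqrt (\<Sum>i\<in>S. f i) \<le> (\<Sum>i\<in>S. sqrt (f i))"
  using assms
proof (induction S rule: finite_induct)
  case (insert i S)
  have "sqrt (f i + sum f S) \<le> sqrt (f i) + sqrt (sum f S)"
    using insert.prems by (intro sqrt_add_le_add_sqrt sum_nonneg) auto
  also have "\<dots> \<le> sqrt (f i) + (\<Sum>i\<in>S. sqrt (f i))" using insert by simp
  finally show ?case using insert.hyps by simp
qed simp

lemma measurable_rdet:
  assumes "\<And>i c. i < k \<Longrightarrow> c < k \<Longrightarrow> (\<lambda>\<omega>. A \<omega> i c) \<in> borel_measurable M"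
  shows "(\<lambda>\<omega>. rdet k (A \<omega>)) \<in> borel_measurable M"
  unfolding rdet_leibniz
proof (intro borel_measurable_sum borel_measurable_times borel_measurable_const borel_measurable_prod)
  fix p i assume "p \<in> {p. p permutes {0..<k}}" "i \<in> {0..<k}"
  then show "(\<lambda>\<omega>. A \<omega> i (p i)) \<in> borel_measurable M"
    using permutes_in_image[of p "{0..<k}" i] by (intro assms) auto
qed

definition eig_coord :: "nat \<Rightarrow> (nat \<Rightarrow> nat \<Rightarrow> real) \<Rightarrow> (nat \<times> nat \<Rightarrow> real) \<Rightarrow> nat \<Rightarrow> nat \<Rightarrow> real" where
  "eig_coord k q \<omega> i s = (\<Sum>a<k. q i a * \<omega> (a, s))"

text \<open>The gradient of \<open>eig_coord k q \<omega> i r\<close> in \<open>\<omega>\<close>: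
  the vector \<open>q i\<close> placed in column \<open>r\<close> of the Gaussian array.\<close>

definition column_dir :: "(nat \<Rightarrow> nat \<Rightarrow> real) \<Rightarrow> nat \<Rightarrow> nat \<Rightarrow> nat \<times> nat \<Rightarrow> real" where
  "column_dir q r i = (\<lambda>(a, s). if s = r then q i a else 0)"

text \<open>Eigenvalues are indexed from 0 here, and \<open>\<eta>\<close> bounds absolute rather
  than relative gaps.\<close>

locale krylov_setup =
  fixes k b t :: nat and q :: "nat \<Rightarrow> nat \<Rightarrow> real" and l :: "nat \<Rightarrow> real" and \<eta> :: real
  assumes k: "k = t * b" and k0: "0 < k"
    and orth: "\<And>i j. i < k \<Longrightarrow> j < k \<Longrightarrow> (\<Sum>a<k. q i a * q j a) = (if i = j then 1 else 0)"
    and l1: "\<And>i. i < k \<Longrightarrow> \<bar>l i\<bar> \<le> 1"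
    and \<eta>: "0 < \<eta>" and gap: "\<And>i j. i < k \<Longrightarrow> j < k \<Longrightarrow> i \<noteq> j \<Longrightarrow> \<eta> \<le> \<bar>l i - l j\<bar>"
begin

abbreviation "I \<equiv> {..<k} \<times> {..<b}"
abbreviation "z \<equiv> eig_coord k q"
abbreviation "full_det \<omega> \<equiv> rdet k (krylov_row l b (z \<omega>))"
abbreviation "cof_det j c \<omega> \<equiv> rdet k ((krylov_row l b (z \<omega>))(j := unit_row c))"

lemma b0: "0 < b" and t0: "0 < t"
  using k k0 by (auto intro!: Nat.gr0I)

lemma finite_I: "finite I" by simp

lemma sum_column:
  assumes "r < b"
  shows "(\<Sum>p\<in>I. column_dir q r i p * f p) = (\<Sum>a<k. q i a * f (a, r))"
proof -
  have "(\<Sum>p\<in>I. column_dir q r i p * f p) = (\<Sum>a<k. \<Sum>s<b. if s = r then q i a * f (a, s) else 0)"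
    unfolding sum.cartesian_product by (intro sum.cong) (auto simp: column_dir_def)
  then show ?thesis using assms by simp
qed

lemma dir_coord_column_dir: "r < b \<Longrightarrow> dir_coord I (column_dir q r i) \<omega> = z \<omega> i r"
  unfolding dir_coord_def eig_coord_def by (rule sum_column)

lemma column_dir_orth:
  assumes "i < k" "j < k" "r < b"
  shows "(\<Sum>p\<in>I. column_dir q r i p * column_dir q r' j p) = (if i = j \<and> r = r' then 1 else 0)"
proof (cases "r = r'")
  case True
  then show ?thesis unfolding sum_column[OF assms(3)] using orth[OF assms(1,2)] by (simp add: column_dir_def)
next
  case False
  then show ?thesis unfolding sum_column[OF assms(3)] by (simp add: column_dir_def)
qed

lemma eig_coord_shift:
  assumes "j < k" "s < b" "i < k"
  shows "z (shift_along I (column_dir q r i) x \<omega>) j s = z \<omega> j s + (if j = i \<and> s = r then x else 0)"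
proof -
  have "z (shift_along I (column_dir q r i) x \<omega>) j s = z \<omega> j s + x * (if s = r then (\<Sum>a<k. q j a * q i a) else 0)"
    using assms(2)
    by (simp add: eig_coord_def shift_along_def column_dir_def algebra_simps sum.distrib sum_distrib_left)
  then show ?thesis using orth[OF assms(1,3)] by (cases "j = i") simp_all
qed

lemma measurable_eig_coord [measurable]:
  assumes "s < b"
  shows "(\<lambda>\<omega>. z \<omega> i s) \<in> borel_measurable (gauss I)"
  unfolding eig_coord_def
proof (intro borel_measurable_sum borel_measurable_times borel_measurable_const)
  fix a assume "a \<in> {..<k}"
  then have "(\<lambda>\<omega>. \<omega> (a, s)) \<in> measurable (gauss I) std_normal"
    using assms by (intro measurable_component_singleton) auto
  then show "(\<lambda>\<omega>. \<omega> (a, s)) \<in> borel_measurable (gauss I)" by simp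
qed

lemma measurable_krylov_row: "(\<lambda>\<omega>. krylov_row l b (z \<omega>) i c) \<in> borel_measurable (gauss I)"
  using b0 unfolding krylov_row_def by (intro borel_measurable_times borel_measurable_const measurable_eig_coord) auto

lemma measurable_krylov_det [measurable]: "(\<lambda>\<omega>. krylov_det k l b r S (z \<omega>)) \<in> borel_measurable (gauss I)"
  unfolding krylov_det_def
proof (rule measurable_rdet)
  fix i c
  show "(\<lambda>\<omega>. (if i \<in> S then power_row l b (r i) i else krylov_row l b (z \<omega>) i) c) \<in> borel_measurable (gauss I)"
    by (cases "i \<in> S") (simp_all add: measurable_krylov_row)
qed

lemma measurable_full_det [measurable]: "full_det \<in> borel_measurable (gauss I)"
  by (rule measurable_rdet) (rule measurable_krylov_row)

lemma measurable_cof_det [measurable]: "cof_det j c \<in> borel_measurable (gauss I)"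
proof (rule measurable_rdet)
  fix i d
  show "(\<lambda>\<omega>. ((krylov_row l b (z \<omega>))(j := unit_row c)) i d) \<in> borel_measurable (gauss I)"
    by (cases "i = j") (simp_all add: measurable_krylov_row)
qed

text \<open>An instance of \<open>gauss_fractional_moment\<close> with the mixed derivatives as
  \<open>F\<close>. Using one variable from each row of \<open>P\<close> makes the directions
  orthonormal and each step affine.\<close>

lemma krylov_det_moment:
  assumes P: "P \<subseteq> {..<k}" and r: "\<And>i. i \<in> P \<Longrightarrow> r i < b"
  shows "(\<integral>\<^sup>+\<omega>. ennreal (sqrt \<bar>krylov_det k l b r P (z \<omega>)\<bar> * (\<Prod>i\<in>P. wt (z \<omega> i (r i)))) * inv_sqrt (full_det \<omega>) \<partial>gauss I)
    \<le> 4 ^ card P"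
proof -
  let ?d = "\<lambda>i. column_dir q (r i) i"
  let ?F = "\<lambda>S \<omega>. krylov_det k l b r S (z \<omega>)"
  have "(\<integral>\<^sup>+\<omega>. ennreal (sqrt \<bar>?F P \<omega>\<bar> * (\<Prod>i\<in>P. wt (dir_coord I (?d i) \<omega>))) * inv_sqrt (?F {} \<omega>) \<partial>gauss I)
      \<le> 4 ^ card P"
  proof (rule gauss_fractional_moment[OF finite_I])
    show "finite P" using P finite_subset by blast
    show "(\<Sum>a\<in>I. ?d i a * ?d j a) = (if i = j then 1 else 0)" if "i \<in> P" "j \<in> P" for i j
    proof -
      have "i < k" "j < k" "r i < b" using that P r by auto
      from column_dir_orth[OF this] show ?thesis by auto
    qed
    show "?F S \<in> borel_measurable (gauss I)" for S by (rule measurable_krylov_det)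
    show "?F S (shift_along I (?d i) x \<omega>) = ?F S \<omega> + x * ?F (insert i S) \<omega>"
      if "S \<subseteq> P" "i \<in> P - S" for S i x \<omega>
      using that P by (intro krylov_det_affine b0 eig_coord_shift) auto
    show "?F P (shift_along I (?d i) x \<omega>) = ?F P \<omega>" if "i \<in> P" for i x \<omega>
    proof (rule krylov_det_cong[OF b0])
      fix j s assume "j < k" "j \<notin> P" "s < b"
      moreover have "i < k" "j \<noteq> i" using that P calculation by auto
      ultimately show "z (shift_along I (?d i) x \<omega>) j s = z \<omega> j s" by (simp add: eig_coord_shift)
    qed
  qed
  moreover have "(\<Prod>i\<in>P. wt (dir_coord I (?d i) \<omega>)) = (\<Prod>i\<in>P. wt (z \<omega> i (r i)))" for \<omega>
    using r by (intro prod.cong) (auto simp: dir_coord_column_dir)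
  moreover have "?F {} \<omega> = full_det \<omega>" for \<omega> by (simp add: krylov_det_def)
  ultimately show ?thesis by simp
qed

text \<open>With \<open>P\<close> the set of all rows, the mixed derivative is a nonzero constant,
  so the integrand is \<open>\<top>\<close> wherever the determinant vanishes. Its integral is
  finite.\<close>

lemma AE_full_det_nonzero: "AE \<omega> in gauss I. full_det \<omega> \<noteq> 0"
proof -
  let ?F = "\<lambda>\<omega>. krylov_det k l b (\<lambda>i. i mod b) {..<k} (z \<omega>)"
  let ?g = "\<lambda>\<omega>. ennreal (sqrt \<bar>?F \<omega>\<bar> * (\<Prod>i<k. wt (z \<omega> i (i mod b)))) * inv_sqrt (full_det \<omega>)"
  have inj: "inj_on l {..<k}"
  proof (rule inj_onI, rule ccontr)
    fix i j assume "i \<in> {..<k}" "j \<in> {..<k}" "l i = l j" "i \<noteq> j"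
    then show False using gap[of i j] \<eta> by simp
  qed
  have [measurable]: "(\<lambda>\<omega>. z \<omega> i (i mod b)) \<in> borel_measurable (gauss I)" for i
    using b0 by (intro measurable_eig_coord) simp
  have "integral\<^sup>N (gauss I) ?g \<le> 4 ^ card {..<k}"
    by (rule krylov_det_moment) (use b0 in auto)
  also have "\<dots> < \<top>" by (simp add: power_less_top_ennreal)
  finally have "integral\<^sup>N (gauss I) ?g \<noteq> \<infinity>" by simp
  then have "AE \<omega> in gauss I. ?g \<omega> \<noteq> \<infinity>" by (intro nn_integral_PInf_AE) measurable
  then show ?thesis
  proof (rule AE_mp, intro AE_I2 impI notI)
    fix \<omega> assume fin: "?g \<omega> \<noteq> \<infinity>" and 0: "full_det \<omega> = 0"
    have "0 < wt x" for x using wt_ge_1[of x] by linarith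
    then have "0 < sqrt \<bar>?F \<omega>\<bar> * (\<Prod>i<k. wt (z \<omega> i (i mod b)))"
      using power_row_det_nonzero[OF k b0 inj] by (intro mult_pos_pos prod_pos) auto
    then have "ennreal (sqrt \<bar>?F \<omega>\<bar> * (\<Prod>i<k. wt (z \<omega> i (i mod b)))) \<noteq> 0"
      by (simp only: ennreal_eq_0_iff not_le)
    then have "?g \<omega> = \<infinity>" by (simp only: 0 inv_sqrt_0 ennreal_mult_top infinity_ennreal_def if_False)
    then show False using fin by contradiction
  qed
qed

text \<open>Square roots are subadditive, so each term of \<open>krylov_cofactor_bound\<close> can
  be treated alone. Its monomial is absorbed by the weights, with \<open>wt (z \<omega> j r)\<close>
  added for row \<open>j\<close>; each term costs \<open>4 ^ t\<close>, and there are at most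
  \<open>k ^ (t - 1)\<close> sets \<open>T\<close>.\<close>

lemma cof_det_moment:
  assumes j: "j < k" and c: "c < k"
  shows "(\<integral>\<^sup>+\<omega>. ennreal (sqrt \<bar>cof_det j c \<omega>\<bar>) * inv_sqrt (full_det \<omega>) \<partial>gauss I)
    \<le> ennreal (sqrt ((2 / \<eta>) ^ (t - 1)) * real k ^ (t - 1) * 4 ^ t)"
proof -
  define r where "r = c mod b"
  have r: "r < b" using b0 by (simp add: r_def)
  define TT where "TT = {T. T \<subseteq> {..<k} - {j} \<and> card T = t - 1}"
  have finTT: "finite TT" by (simp add: TT_def)
  let ?L = "(2 / \<eta>) ^ (t - 1)"
  have L0: "0 \<le> ?L" using \<eta> by simp
  define D where "D T \<omega> = krylov_det k l b (\<lambda>_. r) (insert j T) (z \<omega>)" for T \<omega>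
  define G where "G T \<omega> = sqrt \<bar>D T \<omega>\<bar> * (\<Prod>i\<in>insert j T. wt (z \<omega> i r))" for T \<omega>
  have [measurable]: "D T \<in> borel_measurable (gauss I)" for T unfolding D_def by measurable
  have [measurable]: "(\<lambda>\<omega>. z \<omega> i r) \<in> borel_measurable (gauss I)" for i using r by (rule measurable_eig_coord)
  have [measurable]: "G T \<in> borel_measurable (gauss I)" for T unfolding G_def by measurable
  have wt0: "0 \<le> wt x" for x using wt_ge_1[of x] by linarith
  have G0: "0 \<le> G T \<omega>" for T \<omega> unfolding G_def by (intro mult_nonneg_nonneg prod_nonneg) (auto simp: wt0)
  have pw: "sqrt \<bar>cof_det j c \<omega>\<bar> \<le> sqrt ?L * (\<Sum>T\<in>TT. G T \<omega>)" for \<omega>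
  proof -
    have "\<bar>cof_det j c \<omega>\<bar> \<le> ?L * (\<Sum>T\<in>TT. (\<Prod>i\<in>T. \<bar>z \<omega> i r\<bar>) * \<bar>D T \<omega>\<bar>)"
      unfolding TT_def D_def r_def by (rule krylov_cofactor_bound[OF k j c l1 \<eta> gap])
    then have "sqrt \<bar>cof_det j c \<omega>\<bar> \<le> sqrt ?L * sqrt (\<Sum>T\<in>TT. (\<Prod>i\<in>T. \<bar>z \<omega> i r\<bar>) * \<bar>D T \<omega>\<bar>)"
      by (simp flip: real_sqrt_mult)
    also have "\<dots> \<le> sqrt ?L * (\<Sum>T\<in>TT. sqrt ((\<Prod>i\<in>T. \<bar>z \<omega> i r\<bar>) * \<bar>D T \<omega>\<bar>))"
      using L0 by (intro mult_left_mono sqrt_sum_le_sum_sqrt finTT mult_nonneg_nonneg prod_nonneg) auto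
    also have "\<dots> \<le> sqrt ?L * (\<Sum>T\<in>TT. G T \<omega>)"
    proof (intro mult_left_mono sum_mono)
      fix T assume T: "T \<in> TT"
      then have fT: "finite T" "j \<notin> T" by (auto simp: TT_def intro: finite_subset)
      have "sqrt (\<Prod>i\<in>T. \<bar>z \<omega> i r\<bar>) = (\<Prod>i\<in>T. sqrt \<bar>z \<omega> i r\<bar>)"
        using fT(1) by (induction T rule: finite_induct) (auto simp: real_sqrt_mult)
      also have "\<dots> \<le> (\<Prod>i\<in>T. wt (z \<omega> i r))" by (intro prod_mono) (auto simp: sqrt_le_wt)
      also have "\<dots> \<le> wt (z \<omega> j r) * (\<Prod>i\<in>T. wt (z \<omega> i r))"
        using wt_ge_1[of "z \<omega> j r"] prod_nonneg[of T "\<lambda>i. wt (z \<omega> i r)"] wt0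
        by (simp add: mult_le_cancel_right1)
      finally have "sqrt (\<Prod>i\<in>T. \<bar>z \<omega> i r\<bar>) \<le> (\<Prod>i\<in>insert j T. wt (z \<omega> i r))" using fT by simp
      then show "sqrt ((\<Prod>i\<in>T. \<bar>z \<omega> i r\<bar>) * \<bar>D T \<omega>\<bar>) \<le> G T \<omega>"
        unfolding G_def real_sqrt_mult by (subst mult.commute) (intro mult_left_mono, auto)
    qed (use L0 in simp)
    finally show ?thesis .
  qed
  have "(\<integral>\<^sup>+\<omega>. ennreal (sqrt \<bar>cof_det j c \<omega>\<bar>) * inv_sqrt (full_det \<omega>) \<partial>gauss I)
      \<le> (\<integral>\<^sup>+\<omega>. (\<Sum>T\<in>TT. ennreal (sqrt ?L) * (ennreal (G T \<omega>) * inv_sqrt (full_det \<omega>))) \<partial>gauss I)"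
  proof (rule nn_integral_mono)
    fix \<omega>
    have "ennreal (sqrt \<bar>cof_det j c \<omega>\<bar>) \<le> ennreal (sqrt ?L * (\<Sum>T\<in>TT. G T \<omega>))"
      using pw by (rule ennreal_leI)
    also have "\<dots> = ennreal (sqrt ?L) * (\<Sum>T\<in>TT. ennreal (G T \<omega>))"
      using L0 G0 by (subst ennreal_mult) (auto simp: sum_nonneg)
    finally show "ennreal (sqrt \<bar>cof_det j c \<omega>\<bar>) * inv_sqrt (full_det \<omega>)
        \<le> (\<Sum>T\<in>TT. ennreal (sqrt ?L) * (ennreal (G T \<omega>) * inv_sqrt (full_det \<omega>)))"
      unfolding sum_distrib_left[symmetric] sum_distrib_right[symmetric] mult.assoc[symmetric]
      by (rule mult_right_mono) simp
  qed
  also have "\<dots> = (\<Sum>T\<in>TT. ennreal (sqrt ?L) * (\<integral>\<^sup>+\<omega>. ennreal (G T \<omega>) * inv_sqrt (full_det \<omega>) \<partial>gauss I))"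
    by (subst nn_integral_sum) (auto intro!: sum.cong nn_integral_cmult)
  also have "\<dots> \<le> (\<Sum>T\<in>TT. ennreal (sqrt ?L) * 4 ^ t)"
  proof (intro sum_mono mult_left_mono)
    fix T assume T: "T \<in> TT"
    then have "finite T" "j \<notin> T" "card T = t - 1" by (auto simp: TT_def intro: finite_subset)
    then have "card (insert j T) = t" using t0 by simp
    moreover have "insert j T \<subseteq> {..<k}" using T j by (auto simp: TT_def)
    ultimately show "(\<integral>\<^sup>+\<omega>. ennreal (G T \<omega>) * inv_sqrt (full_det \<omega>) \<partial>gauss I) \<le> 4 ^ t"
      using krylov_det_moment[of "insert j T" "\<lambda>_. r"] r unfolding G_def D_def by simp
  qed simp
  also have "\<dots> = ennreal (real (card TT) * (sqrt ?L * 4 ^ t))"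
  proof -
    have 4: "(4::ennreal) ^ t = ennreal (4 ^ t)" by (simp flip: ennreal_power)
    have "ennreal (sqrt ?L) * 4 ^ t = ennreal (sqrt ?L * 4 ^ t)"
      unfolding 4 by (rule ennreal_mult[symmetric]) (use L0 in auto)
    moreover have "of_nat (card TT) = ennreal (real (card TT))" by (rule ennreal_of_nat_eq_real_of_nat)
    ultimately show ?thesis by (simp only: sum_constant ennreal_mult'[OF of_nat_0_le_iff])
  qed
  also have "\<dots> \<le> ennreal (sqrt ?L * real k ^ (t - 1) * 4 ^ t)"
  proof (rule ennreal_leI)
    have "card TT = card ({..<k} - {j}) choose (t - 1)"
      unfolding TT_def by (rule n_subsets) simp
    also have "card ({..<k} - {j}) = k - 1" using j by simp
    also have "(k - 1) choose (t - 1) \<le> k ^ (t - 1)"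
    proof -
      have "t - 1 \<le> k - 1" using k b0 by (simp add: diff_le_mono)
      then have "(k - 1) choose (t - 1) \<le> (k - 1) ^ (t - 1)" by (rule binomial_le_pow)
      also have "\<dots> \<le> k ^ (t - 1)" by (rule power_mono) auto
      finally show ?thesis .
    qed
    finally have "real (card TT) \<le> real k ^ (t - 1)" by (metis of_nat_le_iff of_nat_power)
    then have "real (card TT) * (sqrt ?L * 4 ^ t) \<le> real k ^ (t - 1) * (sqrt ?L * 4 ^ t)"
      using L0 by (intro mult_right_mono) auto
    then show "real (card TT) * (sqrt ?L * 4 ^ t) \<le> sqrt ?L * real k ^ (t - 1) * 4 ^ t"
      by (simp add: mult_ac)
  qed
  finally show ?thesis .
qed

text \<open>Markov's inequality for the square root of the ratio, hence
  \<open>\<sigma>\<^sup>2\<close> in the event and \<open>\<sigma>\<close> in the bound.\<close>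

lemma cof_det_tail:
  assumes j: "j < k" and c: "c < k" and \<sigma>: "0 < \<sigma>"
  shows "measure (gauss I) {\<omega> \<in> space (gauss I). \<bar>cof_det j c \<omega>\<bar> > \<sigma>\<^sup>2 * \<bar>full_det \<omega>\<bar>}
    \<le> sqrt ((2 / \<eta>) ^ (t - 1)) * real k ^ (t - 1) * 4 ^ t / \<sigma>"
    (is "measure _ ?E \<le> ?m / \<sigma>")
proof -
  interpret prob_space "gauss I" by (rule prob_space_gauss)
  let ?u = "\<lambda>\<omega>. ennreal (sqrt \<bar>cof_det j c \<omega>\<bar>) * inv_sqrt (full_det \<omega>)"
  have "?E \<subseteq> {\<omega> \<in> space (gauss I). 1 \<le> ennreal (1 / \<sigma>) * ?u \<omega>}"
  proof safe
    fix \<omega> assume E: "\<bar>cof_det j c \<omega>\<bar> > \<sigma>\<^sup>2 * \<bar>full_det \<omega>\<bar>"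
    show "1 \<le> ennreal (1 / \<sigma>) * ?u \<omega>"
    proof (cases "full_det \<omega> = 0")
      \<comment> \<open>The strict inequality in the event makes the cofactor nonzero, so
        \<open>?u\<close> is \<open>\<top>\<close> here.\<close>
      case True
      then show ?thesis using E \<sigma> by (simp add: ennreal_mult_top)
    next
      case False
      have "\<sigma> * sqrt \<bar>full_det \<omega>\<bar> \<le> sqrt \<bar>cof_det j c \<omega>\<bar>"
        using real_sqrt_le_mono[OF less_imp_le[OF E]] \<sigma> by (simp add: real_sqrt_mult)
      then have "1 \<le> 1 / \<sigma> * (sqrt \<bar>cof_det j c \<omega>\<bar> * (1 / sqrt \<bar>full_det \<omega>\<bar>))"
        using \<sigma> False by (simp add: field_simps)
      then have "ennreal 1 \<le> ennreal (1 / \<sigma> * (sqrt \<bar>cof_det j c \<omega>\<bar> * (1 / sqrt \<bar>full_det \<omega>\<bar>)))"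
        by (rule ennreal_leI)
      also have "\<dots> = ennreal (1 / \<sigma>) * ?u \<omega>"
      proof -
        have "0 \<le> 1 / \<sigma>" "0 \<le> sqrt \<bar>cof_det j c \<omega>\<bar>" using \<sigma> by auto
        then show ?thesis unfolding inv_sqrt_nonzero[OF False] by (simp only: ennreal_mult')
      qed
      finally show ?thesis by simp
    qed
  qed
  then have "emeasure (gauss I) ?E \<le> emeasure (gauss I) {\<omega> \<in> space (gauss I). 1 \<le> ennreal (1 / \<sigma>) * ?u \<omega>}"
    by (rule emeasure_mono) measurable
  also have "\<dots> \<le> ennreal (1 / \<sigma>) * (\<integral>\<^sup>+\<omega>. ?u \<omega> * indicator (space (gauss I)) \<omega> \<partial>gauss I)"
    by (rule nn_integral_Markov_inequality) measurable
  also have "(\<integral>\<^sup>+\<omega>. ?u \<omega> * indicator (space (gauss I)) \<omega> \<partial>gauss I) = (\<integral>\<^sup>+\<omega>. ?u \<omega> \<partial>gauss I)"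
    by (intro nn_integral_cong) simp
  also have "ennreal (1 / \<sigma>) * \<dots> \<le> ennreal (1 / \<sigma>) * ennreal ?m"
    by (intro mult_left_mono cof_det_moment j c) simp
  also have "\<dots> = ennreal (?m / \<sigma>)" using \<sigma> \<eta> by (simp flip: ennreal_mult)
  finally have "ennreal (prob ?E) \<le> ennreal (?m / \<sigma>)" unfolding emeasure_eq_measure .
  then show ?thesis by (subst (asm) ennreal_le_iff) (use \<sigma> \<eta> in auto)
qed

text \<open>The exponent \<open>t + 1\<close> in \<open>\<sigma>\<close> exceeds that of the moment
  bound by 2, so each of the \<open>k\<^sup>2\<close> tail events has probability at most
  \<open>\<delta> / (real k)\<^sup>2\<close>. A union bound also removes the null set of singular
  matrices.\<close>

lemma good_event:
  assumes \<delta>: "0 < \<delta>"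
  defines "\<sigma> \<equiv> sqrt ((2 / \<eta>) ^ (t - 1)) * real k ^ (t + 1) * 4 ^ t / \<delta>"
  obtains G where "G \<in> sets (gauss I)" "measure (gauss I) G \<ge> 1 - \<delta>"
    "\<And>\<omega>. \<omega> \<in> G \<Longrightarrow> full_det \<omega> \<noteq> 0"
    "\<And>\<omega> j c. \<omega> \<in> G \<Longrightarrow> j < k \<Longrightarrow> c < k \<Longrightarrow> \<bar>cof_det j c \<omega>\<bar> \<le> \<sigma>\<^sup>2 * \<bar>full_det \<omega>\<bar>"
proof -
  interpret prob_space "gauss I" by (rule prob_space_gauss)
  have \<sigma>0: "0 < \<sigma>" unfolding \<sigma>_def using \<delta> \<eta> k0 by simp
  define E where "E = (\<lambda>(j, c). {\<omega> \<in> space (gauss I). \<bar>cof_det j c \<omega>\<bar> > \<sigma>\<^sup>2 * \<bar>full_det \<omega>\<bar>})"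
  define Z where "Z = {\<omega> \<in> space (gauss I). full_det \<omega> = 0}"
  have Em: "E p \<in> sets (gauss I)" for p unfolding E_def by (cases p) simp
  have Zm: "Z \<in> sets (gauss I)" unfolding Z_def by measurable
  have Z0: "prob Z = 0"
  proof -
    have "AE \<omega> in gauss I. \<omega> \<notin> Z" using AE_full_det_nonzero by (rule AE_mp) (auto simp: Z_def)
    then show ?thesis using Zm by (simp add: AE_iff_measurable[OF _ refl] prob_eq_0)
  qed
  let ?K = "{..<k} \<times> {..<k}"
  define U where "U = Z \<union> (\<Union>p\<in>?K. E p)"
  have Um: "U \<in> sets (gauss I)" unfolding U_def using Zm Em by (intro sets.Un sets.finite_UN) auto
  have "prob U \<le> prob Z + prob (\<Union>p\<in>?K. E p)"
    unfolding U_def using Zm Em by (intro measure_Un_le sets.finite_UN) auto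
  also have "prob (\<Union>p\<in>?K. E p) \<le> (\<Sum>p\<in>?K. prob (E p))"
    using Em by (intro finite_measure_subadditive_finite) auto
  also have "(\<Sum>p\<in>?K. prob (E p)) \<le> (\<Sum>p\<in>?K. \<delta> / (real k)\<^sup>2)"
  proof (rule sum_mono)
    fix p assume "p \<in> ?K"
    then obtain j c where p: "p = (j, c)" "j < k" "c < k" by auto
    have kk: "real k ^ (t + 1) = real k ^ (t - 1) * (real k)\<^sup>2"
      using t0 by (simp flip: power_add)
    have "prob (E p) \<le> sqrt ((2 / \<eta>) ^ (t - 1)) * real k ^ (t - 1) * 4 ^ t / \<sigma>"
      unfolding E_def p(1) prod.case by (rule cof_det_tail[OF p(2,3) \<sigma>0])
    also have "\<dots> = \<delta> / (real k)\<^sup>2"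
      unfolding \<sigma>_def kk using \<delta> \<eta> k0 by (simp add: field_simps)
    finally show "prob (E p) \<le> \<delta> / (real k)\<^sup>2" .
  qed
  also have "\<dots> = \<delta>" using k0 by (simp add: power2_eq_square)
  finally have "prob U \<le> \<delta>" using Z0 by simp
  then have "prob (space (gauss I) - U) \<ge> 1 - \<delta>" using Um by (simp add: prob_compl)
  then show thesis
    by (intro that[of "space (gauss I) - U"])
       (use Um in \<open>auto simp: U_def E_def Z_def not_less\<close>)
qed

end

section \<open>Eigenvalue gaps and the final estimate\<close>

lemma telescope_ge:
  fixes l :: "nat \<Rightarrow> real"
  assumes "\<And>i. 1 \<le> i \<Longrightarrow> i < k \<Longrightarrow> e \<le> l i - l (i + 1)" "1 \<le> i" "i + m \<le> k"
  shows "real m * e \<le> l i - l (i + m)"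
  using assms(3)
proof (induction m)
  case (Suc m)
  have "e \<le> l (i + m) - l (i + m + 1)" using assms(1)[of "i + m"] assms(2) Suc.prems by simp
  then show ?case using Suc by (simp add: distrib_right)
qed simp

text \<open>A gap is at least the minimal relative gap times \<open>l i\<close>, and
  \<open>l i\<close> is at least \<open>l (k - 1)\<close>, the inverse of
  \<open>eig_ratio k l\<close> since \<open>l 1 = 1\<close>. The last eigenvalue may be 0, but
  \<open>l (k - 1)\<close> is positive.\<close>

lemma relative_gap:
  fixes l :: "nat \<Rightarrow> real"
  assumes k: "2 \<le> k" and l1: "l 1 = 1" and dec: "\<forall>i\<in>{1..<k}. l (i + 1) < l i" and lk: "0 \<le> l k"
  defines "\<eta> \<equiv> min_rel_gap k l / eig_ratio k l"
  shows "0 < \<eta>" "\<And>i. 1 \<le> i \<Longrightarrow> i < k \<Longrightarrow> \<eta> \<le> l i - l (i + 1)"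
proof -
  have mono: "l (i + m) \<le> l i" if "1 \<le> i" "i + m \<le> k" for i m
    \<comment> \<open>Telescoping with step 0 gives monotonicity.\<close>
    using telescope_ge[of k 0 l i m] dec that by (force simp: less_imp_le)
  have pos: "0 < l i" if "1 \<le> i" "i < k" for i
  proof -
    have "l (i + 1) < l i" using dec that by simp
    moreover have "l k \<le> l (i + 1)" using mono[of "i + 1" "k - (i + 1)"] that by simp
    ultimately show ?thesis using lk by linarith
  qed
  define X where "X = (\<lambda>i. (l i - l (i + 1)) / l i) ` {1..k - 1}"
  have X: "finite X" "X \<noteq> {}" using k by (auto simp: X_def)
  have "0 < x" if "x \<in> X" for x
    using that dec pos by (auto simp: X_def intro!: divide_pos_pos)
  then have M: "0 < min_rel_gap k l"
    unfolding min_rel_gap_def X_def[symmetric] using X by simp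
  have lk1: "0 < l (k - 1)" using pos[of "k - 1"] k by simp
  have \<eta>: "\<eta> = min_rel_gap k l * l (k - 1)" unfolding \<eta>_def eig_ratio_def l1 by simp
  then show "0 < \<eta>" using M lk1 by simp
  fix i assume i: "1 \<le> i" "i < k"
  have "min_rel_gap k l \<le> (l i - l (i + 1)) / l i"
    unfolding min_rel_gap_def by (rule Min_le) (use i in auto)
  then have "min_rel_gap k l * l i \<le> l i - l (i + 1)"
    using pos[OF i] by (simp add: pos_le_divide_eq)
  moreover have "l (k - 1) \<le> l i" using mono[of i "k - 1 - i"] i by simp
  then have "\<eta> \<le> min_rel_gap k l * l i" unfolding \<eta> using M by (intro mult_left_mono) auto
  ultimately show "\<eta> \<le> l i - l (i + 1)" by linarith
qed

text \<open>The square of \<open>\<sigma>\<close> contains the power \<open>t - 1\<close> of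
  \<open>32 * (real k)\<^sup>2 / \<eta>\<close>. With x = \<open>\<eta> / 6\<close>, k x is at most
  1/2, so x^6 = x x^2 x^3 is at most x / (32 k^2): the sixth power absorbs the growing powers of
  \<open>k\<close>. The constant 1/16 pays for the square of one factor 4.\<close>

lemma bound_comparison:
  fixes k t :: nat and \<eta> \<delta> :: real
  assumes k: "1 \<le> k" and t: "1 \<le> t" and \<eta>: "0 < \<eta>" "t \<noteq> 1 \<Longrightarrow> real k * \<eta> \<le> 3" and \<delta>: "0 < \<delta>" "\<delta> < 1"
  defines "\<sigma> \<equiv> sqrt ((2 / \<eta>) ^ (t - 1)) * real k ^ (t + 1) * 4 ^ t / \<delta>"
  shows "1 / 16 * (\<delta> ^ 5 / real k ^ 14) * (\<eta> / 6) ^ (6 * (t - 1)) \<le> 1 / (real k * \<sigma>\<^sup>2)"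
proof -
  obtain m where m: "t = Suc m" using t by (cases t) auto
  have k0: "0 < real k" "1 \<le> real k" using k by auto
  have sm: "((\<eta> / 6) ^ 6) ^ m \<le> (\<eta> / (32 * (real k)\<^sup>2)) ^ m"
  proof (cases "m = 0")
    case False
    define x where "x = \<eta> / 6"
    have x: "0 < x" "real k * x \<le> 1/2" using \<eta> False m by (auto simp: x_def mult.commute)
    have "x * 1 \<le> x * real k" using x k0 by (intro mult_left_mono) auto
    then have x2: "x \<le> 1/2" using x(2) mult.commute[of x "real k"] by linarith
    have a: "x ^ 3 \<le> (1/2) ^ 3" using x x2 by (intro power_mono) auto
    have "(real k * x)\<^sup>2 \<le> (1/2)\<^sup>2" using x k0 by (intro power_mono) auto
    then have b: "x\<^sup>2 \<le> 1 / (4 * (real k)\<^sup>2)" using k0 by (simp add: power_mult_distrib field_simps power2_eq_square)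
    have "x ^ 6 = x * (x\<^sup>2 * x ^ 3)" by (simp flip: power_add power_Suc)
    also have "\<dots> \<le> x * (1 / (4 * (real k)\<^sup>2) * (1/2) ^ 3)"
      using x a b by (intro mult_left_mono mult_mono) auto
    also have "\<dots> = x / (32 * (real k)\<^sup>2)" by (simp add: power3_eq_cube)
    also have "\<dots> \<le> \<eta> / (32 * (real k)\<^sup>2)" using \<eta>(1) k0 by (intro divide_right_mono) (auto simp: x_def)
    finally show ?thesis using x by (intro power_mono) (auto simp: x_def)
  qed simp
  have "\<delta> ^ 5 / real k ^ 14 \<le> \<delta>\<^sup>2 / real k ^ 5"
    using \<delta> k0 by (intro frac_le power_decreasing power_increasing) auto
  then have "1 / 16 * (\<delta> ^ 5 / real k ^ 14) * (\<eta> / 6) ^ (6 * (t - 1))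
      \<le> 1 / 16 * (\<delta>\<^sup>2 / real k ^ 5) * (\<eta> / (32 * (real k)\<^sup>2)) ^ m"
    using sm \<eta>(1) \<delta> unfolding m by (intro mult_mono) (auto simp: power_mult)
  also have "\<dots> = 1 / (real k * \<sigma>\<^sup>2)"
  proof -
    have "\<sigma>\<^sup>2 = (2 / \<eta>) ^ m * (real k ^ (m + 2))\<^sup>2 * (4 ^ Suc m)\<^sup>2 / \<delta>\<^sup>2"
      unfolding \<sigma>_def m using \<eta>(1) by (simp add: power_mult_distrib power_divide)
    also have "(4 ^ Suc m)\<^sup>2 = (16 * 16 ^ m :: real)" by (simp add: power2_eq_square flip: power_mult_distrib)
    also have "(real k ^ (m + 2))\<^sup>2 = real k ^ 4 * ((real k)\<^sup>2) ^ m"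
      by (simp add: power_add power_mult_distrib flip: power_mult) (simp add: mult.commute)
    finally have \<sigma>2: "\<sigma>\<^sup>2 = (2 / \<eta>) ^ m * (real k ^ 4 * ((real k)\<^sup>2) ^ m) * (16 * 16 ^ m) / \<delta>\<^sup>2" .
    have e: "\<eta> / (32 * (real k)\<^sup>2) = 1 / ((2 / \<eta>) * (real k)\<^sup>2 * 16)" using \<eta>(1) by simp
    have "real k ^ 5 = real k * real k ^ 4" by (simp flip: power_Suc)
    then show ?thesis
      unfolding \<sigma>2 e power_one_over power_mult_distrib using \<delta> by simp
  qed
  finally show ?thesis .
qed

text \<open>By the Rayleigh characterisation with rational test vectors, the event is a countable
  intersection of polynomial inequalities in the entries.\<close>

lemma measurable_sigma_min_ge:
  assumes "\<And>\<omega>. A \<omega> \<in> carrier_mat k k" "0 < k" "0 \<le> s"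
    and meas: "\<And>i c. i < k \<Longrightarrow> c < k \<Longrightarrow> (\<lambda>\<omega>. A \<omega> $$ (i, c)) \<in> borel_measurable M"
  shows "{\<omega> \<in> space M. sigma_min (A \<omega>) \<ge> s} \<in> sets M"
proof -
  let ?P = "\<lambda>\<omega> (xs :: rat list). s\<^sup>2 * sqnorm k (\<lambda>i. of_rat (xs ! i))
      \<le> sqnorm k (mulv k (\<lambda>i c. A \<omega> $$ (i, c)) (\<lambda>i. of_rat (xs ! i)))"
  have "{\<omega> \<in> space M. sigma_min (A \<omega>) \<ge> s} = {\<omega> \<in> space M. \<forall>xs. ?P \<omega> xs}"
    unfolding sigma_min_ge_iff[OF assms(1-3)] using rational_test_vectors by blast
  moreover have "{\<omega> \<in> space M. ?P \<omega> xs} \<in> sets M" for xs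
  proof -
    have "(\<lambda>\<omega>. sqnorm k (mulv k (\<lambda>i c. A \<omega> $$ (i, c)) (\<lambda>i. of_rat (xs ! i)))) \<in> borel_measurable M"
      unfolding sqnorm_def mulv_def using meas
      by (intro borel_measurable_sum borel_measurable_power borel_measurable_times borel_measurable_const) auto
    then show ?thesis by measurable
  qed
  ultimately show ?thesis by (simp add: sets.sets_Collect_countable_All)
qed

lemma krylov_mat_index:
  assumes "C \<in> carrier_mat k k" "i < k" "c < t * b" "0 < b"
  shows "krylov_mat C (mat k b \<omega>) t $$ (i, c) = (\<Sum>a<k. (C ^\<^sub>m (c div b)) $$ (i, a) * \<omega> (a, c mod b))"
proof -
  have "C ^\<^sub>m (c div b) \<in> carrier_mat k k" using assms(1) by (rule pow_carrier_mat)
  then show ?thesis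
    using assms by (simp add: krylov_mat_def scalar_prod_def lessThan_atLeast0)
qed

theorem theorem4:
  "\<exists>c::real. c > 0 \<and>
     (\<forall>(k::nat) (b::nat) (t::nat) (C::real mat) (l::nat \<Rightarrow> real) (\<delta>::real).
        k \<ge> 1 \<and> b \<ge> 1 \<and> b dvd k \<and> t = k div b \<and>
        C \<in> carrier_mat k k \<and> C\<^sup>T = C \<and>
        spectrum C = l ` {1..k} \<and>
        l 1 = 1 \<and> (\<forall>i\<in>{1..<k}. l (i + 1) < l i) \<and> l k \<ge> 0 \<and>
        0 < \<delta> \<and> \<delta> < 1 \<longrightarrow>
        \<P>(\<omega> in gaussian_entries k b.
            sigma_min (krylov_mat C (mat k b \<omega>) t)
              \<ge> c * (\<delta> ^ 5 / real k ^ 14) *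
                 (min_rel_gap k l / (6 * eig_ratio k l)) ^ (6 * (t - 1)))
          \<ge> 1 - \<delta>)"
proof (intro exI[of _ "1/16"] conjI allI impI)
  fix k b t :: nat and C :: "real mat" and l :: "nat \<Rightarrow> real" and \<delta> :: real
  assume asm: "k \<ge> 1 \<and> b \<ge> 1 \<and> b dvd k \<and> t = k div b \<and>
        C \<in> carrier_mat k k \<and> C\<^sup>T = C \<and>
        spectrum C = l ` {1..k} \<and>
        l 1 = 1 \<and> (\<forall>i\<in>{1..<k}. l (i + 1) < l i) \<and> l k \<ge> 0 \<and>
        0 < \<delta> \<and> \<delta> < 1"
  then have k1: "1 \<le> k" and b0: "0 < b" and C: "C \<in> carrier_mat k k" and sym: "C\<^sup>T = C"
    and spec: "spectrum C = l ` {1..k}" and l_1: "l 1 = 1"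
    and dec: "\<forall>i\<in>{1..<k}. l (i + 1) < l i" and lk: "0 \<le> l k" and \<delta>: "0 < \<delta>" "\<delta> < 1"
    by auto
  have k: "k = t * b" using asm by simp
  have t1: "1 \<le> t" using k k1 by (auto intro!: Suc_leI Nat.gr0I)
  \<comment> \<open>For \<open>k = 1\<close> the relative gap is a minimum over the empty set. Then
    \<open>t = 1\<close> and the exponent is 0, so any positive value serves.\<close>
  define \<eta> where "\<eta> = (if k = 1 then 1 else min_rel_gap k l / eig_ratio k l)"
  have \<eta>0: "0 < \<eta>" and step: "\<And>i. 1 \<le> i \<Longrightarrow> i < k \<Longrightarrow> \<eta> \<le> l i - l (i + 1)"
    using relative_gap[of k l, OF _ l_1 dec lk] k1 by (auto simp: \<eta>_def)
  have tel: "real m * \<eta> \<le> l i - l (i + m)" if "1 \<le> i" "i + m \<le> k" for i m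
    using step that by (rule telescope_ge)
  define l' where "l' i = l (Suc i)" for i
  have gap0: "\<eta> \<le> l' i - l' j" if "i < j" "j < k" for i j
  proof -
    have "1 * \<eta> \<le> real (j - i) * \<eta>" using that \<eta>0 by (intro mult_right_mono) auto
    also have "\<dots> \<le> l' i - l' j" using tel[of "Suc i" "j - i"] that by (simp add: l'_def)
    finally show ?thesis by simp
  qed
  have gap: "\<eta> \<le> \<bar>l' i - l' j\<bar>" if "i < k" "j < k" "i \<noteq> j" for i j
    using gap0[of i j] gap0[of j i] that \<eta>0 by (cases "i < j") auto
  have l'1: "\<bar>l' i\<bar> \<le> 1" if "i < k" for i
  proof -
    have "0 \<le> real i * \<eta>" "0 \<le> real (k - Suc i) * \<eta>" using \<eta>0 by auto
    then show ?thesis using tel[of 1 i] tel[of "Suc i" "k - Suc i"] that l_1 lk by (auto simp: l'_def)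
  qed
  have inj: "inj_on l' {..<k}"
  proof (rule inj_onI, rule ccontr)
    fix i j assume "i \<in> {..<k}" "j \<in> {..<k}" "l' i = l' j" "i \<noteq> j"
    then show False using gap[of i j] \<eta>0 by simp
  qed
  have eig: "l' i \<in> spectrum C" if "i < k" for i using that by (auto simp: l'_def spec)
  obtain q :: "nat \<Rightarrow> nat \<Rightarrow> real" where
    orth: "\<And>i j. i < k \<Longrightarrow> j < k \<Longrightarrow> (\<Sum>a<k. q i a * q j a) = (if i = j then 1 else 0)"
    and qC: "\<And>i s c. i < k \<Longrightarrow> c < k \<Longrightarrow> (\<Sum>a<k. q i a * (C ^\<^sub>m s) $$ (a, c)) = l' i ^ s * q i c"
    using orthonormal_eigenbasis[OF C sym eig inj] by blast
  interpret krylov_setup k b t q l' \<eta>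
    by standard (use k k1 orth l'1 \<eta>0 gap in auto)
  define K where "K \<omega> = krylov_mat C (mat k b \<omega>) t" for \<omega>
  have Kc: "K \<omega> \<in> carrier_mat k k" for \<omega> unfolding K_def krylov_mat_def using k by simp
  have Ki: "K \<omega> $$ (i, c) = (\<Sum>a<k. (C ^\<^sub>m (c div b)) $$ (i, a) * \<omega> (a, c mod b))"
    if "i < k" "c < k" for \<omega> i c
    unfolding K_def using krylov_mat_index[OF C that(1)] that(2) k b0 by simp
  \<comment> \<open>Multiplying by the orthogonal matrix \<open>q\<close> turns the Krylov matrix
    into the matrix of rows \<open>krylov_row\<close> and preserves norms.\<close>
  have rotK: "mulv k q (mulv k (\<lambda>i c. K \<omega> $$ (i, c)) x) i = mulv k (krylov_row l' b (z \<omega>)) x i"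
    if i: "i < k" for \<omega> x i
  proof -
    have "(\<Sum>a<k. q i a * K \<omega> $$ (a, c)) = krylov_row l' b (z \<omega>) i c" if c: "c < k" for c
    proof -
      have "(\<Sum>a<k. q i a * K \<omega> $$ (a, c))
          = (\<Sum>a<k. \<Sum>d<k. q i a * (C ^\<^sub>m (c div b)) $$ (a, d) * \<omega> (d, c mod b))"
        using Ki c by (simp add: sum_distrib_left mult.assoc)
      also have "\<dots> = (\<Sum>d<k. (\<Sum>a<k. q i a * (C ^\<^sub>m (c div b)) $$ (a, d)) * \<omega> (d, c mod b))"
        by (subst sum.swap) (simp add: sum_distrib_right)
      also have "\<dots> = krylov_row l' b (z \<omega>) i c"
        using qC[OF i] by (simp add: krylov_row_def eig_coord_def sum_distrib_left mult.assoc)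
      finally show ?thesis .
    qed
    then have "mulv k (krylov_row l' b (z \<omega>)) x i = (\<Sum>c<k. (\<Sum>a<k. q i a * K \<omega> $$ (a, c)) * x c)"
      by (simp add: mulv_def)
    also have "\<dots> = (\<Sum>a<k. q i a * (\<Sum>c<k. K \<omega> $$ (a, c) * x c))"
      by (simp add: sum_distrib_left sum_distrib_right mult.assoc) (rule sum.swap)
    finally show ?thesis by (simp add: mulv_def)
  qed
  have normK: "sqnorm k (mulv k (\<lambda>i c. K \<omega> $$ (i, c)) x) = sqnorm k (mulv k (krylov_row l' b (z \<omega>)) x)" for \<omega> x
    using sqnorm_orthonormal[OF orth, of "mulv k (\<lambda>i c. K \<omega> $$ (i, c)) x"] rotK by (simp add: sqnorm_def)
  define \<sigma> where "\<sigma> = sqrt ((2 / \<eta>) ^ (t - 1)) * real k ^ (t + 1) * 4 ^ t / \<delta>"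
  define S where "S = 1 / 16 * (\<delta> ^ 5 / real k ^ 14) * (min_rel_gap k l / (6 * eig_ratio k l)) ^ (6 * (t - 1))"
  have S_eq: "S = 1 / 16 * (\<delta> ^ 5 / real k ^ 14) * (\<eta> / 6) ^ (6 * (t - 1))"
  proof (cases "t = 1")
    case False
    have "t \<le> k" using k b0 by simp
    then have "k \<noteq> 1" using False t1 by simp
    then show ?thesis by (simp add: S_def \<eta>_def mult.commute)
  qed (simp add: S_def)
  have S0: "0 \<le> S" unfolding S_eq using \<delta> \<eta>0 by simp
  have S_le: "S \<le> 1 / (real k * \<sigma>\<^sup>2)"
    unfolding S_eq \<sigma>_def
  proof (rule bound_comparison[OF k1 t1 \<eta>0 _ \<delta>])
    assume "t \<noteq> 1"
    moreover have "t \<le> k" using k b0 by simp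
    ultimately have k2: "2 \<le> k" using t1 by simp
    \<comment> \<open>All eigenvalues lie in an interval of length 1 that contains
      \<open>k - 1\<close> gaps; \<open>k\<close> is at most \<open>2 * (k - 1)\<close>, so the
      product with \<open>k\<close> is at most 2.\<close>
    have "real (k - 1) * \<eta> \<le> 1" using tel[of 1 "k - 1"] k1 l_1 lk by simp
    moreover have "real k * \<eta> \<le> (2 * real (k - 1)) * \<eta>" using k2 \<eta>0 by (intro mult_right_mono) auto
    ultimately show "real k * \<eta> \<le> 3" by simp
  qed
  obtain G where G: "G \<in> sets (gauss I)" "measure (gauss I) G \<ge> 1 - \<delta>"
    and G1: "\<And>\<omega>. \<omega> \<in> G \<Longrightarrow> full_det \<omega> \<noteq> 0"
    and G2: "\<And>\<omega> j c. \<omega> \<in> G \<Longrightarrow> j < k \<Longrightarrow> c < k \<Longrightarrow> \<bar>cof_det j c \<omega>\<bar> \<le> \<sigma>\<^sup>2 * \<bar>full_det \<omega>\<bar>"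
    unfolding \<sigma>_def by (rule good_event[OF \<delta>(1)]) metis
  let ?E = "{\<omega> \<in> space (gauss I). sigma_min (K \<omega>) \<ge> S}"
  have "G \<subseteq> ?E"
  proof
    fix \<omega> assume \<omega>: "\<omega> \<in> G"
    have "S\<^sup>2 * sqnorm k x \<le> sqnorm k (mulv k (\<lambda>i c. K \<omega> $$ (i, c)) x)" for x
    proof -
      let ?y = "sqnorm k (mulv k (krylov_row l' b (z \<omega>)) x)"
      have \<sigma>0: "0 < real k * \<sigma>\<^sup>2" using k1 \<eta>0 \<delta> by (simp add: \<sigma>_def)
      \<comment> \<open>The cofactor bound with \<open>\<sigma>\<^sup>2\<close> as
        \<open>\<tau>\<close> bounds the norm of the inverse by
        \<open>real k * \<sigma>\<^sup>2\<close>, whose reciprocal is at least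
        \<open>S\<close>.\<close>
      have "sqnorm k x \<le> (real k * \<sigma>\<^sup>2)\<^sup>2 * ?y"
        unfolding sqnorm_def mulv_def
        by (rule norm_bound_of_cofactors) (use G1 G2 \<omega> in auto)
      then have "S\<^sup>2 * sqnorm k x \<le> S\<^sup>2 * ((real k * \<sigma>\<^sup>2)\<^sup>2 * ?y)" by (rule mult_left_mono) simp
      also have "\<dots> = (S * (real k * \<sigma>\<^sup>2))\<^sup>2 * ?y" by (simp add: power_mult_distrib mult.assoc)
      also have "\<dots> \<le> 1\<^sup>2 * ?y"
      proof (intro mult_right_mono power_mono sqnorm_nonneg)
        show "S * (real k * \<sigma>\<^sup>2) \<le> 1" using S_le \<sigma>0 by (simp only: pos_le_divide_eq)
      qed (use S0 \<sigma>0 in auto)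
      finally show ?thesis by (simp add: normK)
    qed
    then have "S \<le> sigma_min (K \<omega>)" using sigma_min_ge_iff[OF Kc k0 S0] by blast
    then show "\<omega> \<in> ?E" using sets.sets_into_space[OF G(1)] \<omega> by auto
  qed
  moreover have "?E \<in> sets (gauss I)"
  proof (rule measurable_sigma_min_ge[OF Kc k0 S0])
    fix i c assume "i < k" "c < k"
    moreover have "(\<lambda>\<omega>. \<omega> (a, c mod b)) \<in> borel_measurable (gauss I)" if "a < k" for a
    proof -
      have "(\<lambda>\<omega>. \<omega> (a, c mod b)) \<in> measurable (gauss I) std_normal"
        using that b0 by (intro measurable_component_singleton) auto
      then show ?thesis by simp
    qed
    ultimately show "(\<lambda>\<omega>. K \<omega> $$ (i, c)) \<in> borel_measurable (gauss I)"
      by (auto simp: Ki intro!: borel_measurable_sum borel_measurable_times)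
  qed
  ultimately have "measure (gauss I) G \<le> measure (gauss I) ?E"
    using prob_space.finite_measure[OF prob_space_gauss, of I] by (intro finite_measure.finite_measure_mono)
  then have "1 - \<delta> \<le> measure (gauss I) ?E" using G(2) by simp
  then show "\<P>(\<omega> in gaussian_entries k b. sigma_min (krylov_mat C (mat k b \<omega>) t)
      \<ge> 1 / 16 * (\<delta> ^ 5 / real k ^ 14) * (min_rel_gap k l / (6 * eig_ratio k l)) ^ (6 * (t - 1))) \<ge> 1 - \<delta>"
    unfolding gaussian_entries_def K_def S_def .
qed simp

end
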